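(* Let $(\Omega, \mathcal{F}, \mathbf{F}, \mathbb{P})$ be a filtered probability space such that the filtration $\mathbf{F} = (\mathcal{F}_t)_{t \geq 0}$ satisfies the usual conditions. Let $X : \Omega \times \mathbb{R}_+ \to \mathbb{R}$ be an optional process such that all trajectories of $X$ are regulated, and put $\Delta X_0 := 0$. Then the function $$j_X : \Omega \times (\mathcal{B}(\mathbb{R}_+) \otimes \mathcal{B}(\mathbb{R})) \to \mathbb{Z}_+ \cup \{+\infty\}, \qquad (\omega, G) \mapsto \sum_{s > 0} 1_G(s, \Delta X_s(\omega))\, 1_{\{\Delta X \neq 0\}}(\omega, s)$$ is an integer-valued random measure.
   Context: $\mathbb{R}_+ = [0,\infty)$. Usual conditions: $\mathcal{F}_0$ contains all $\mathbb{P}$-null sets and $\mathbf{F}$ is right-continuous. A process is optional if it is measurable with respect to the optional $\sigma$-field $\mathcal{O}$ on $\Omega \times \mathbb{R}_+$, generated by all càdlàg adapted processes; the predictable $\sigma$-field $\mathcal{P}$ is generated by all left-continuous adapted processes. A function $f : \mathbb{R}_+ \to \mathbb{R}$ is regulated if the finite limits $f(t-)$ and $f(t+)$ exist for every $t > 0$ and the finite limit $f(0+)$ exists. For $X$ with regulated trajectories, $X_{t+}$ and $X_{t-}$ ($t>0$) are the pathwise right-hand and left-hand limits, $X_{0-} := X_{0+}$, and $\Delta X_t := X_{t+} - X_{t-}$ (so $\Delta X_0 = 0$). $\{\Delta X \neq 0\} = \{(\omega,s) \in \Omega \times \mathbb{R}_+ : \Delta X_s(\omega) \neq 0\}$, and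 $1_A$ is the indicator function of $A$. The sum over $s>0$ is an unordered sum: for $h : L \to \mathbb{R}_+$, $\sum_{s \in L} h(s) := \sup\{\sum_{s \in F} h(s) : F \subseteq L \text{ finite}\} \in [0,\infty]$. Integer-valued random measure (standard notion of the general theory of stochastic processes) on $\mathbb{R}_+ \times \mathbb{R}$: a map $\mu : \Omega \times (\mathcal{B}(\mathbb{R}_+) \otimes \mathcal{B}(\mathbb{R})) \to [0,\infty]$ such that $\mu(\omega,\cdot)$ is a measure for every $\omega$ with $\mu(\omega, \{0\} \times \mathbb{R}) = 0$; $\mu(\cdot, G)$ is $\mathcal{F}$-measurable with values in $\mathbb{Z}_+ \cup \{+\infty\}$ for every $G$; $\mu(\omega, \{t\} \times \mathbb{R}) \leq 1$ for all $(\omega,t)$; $\mu$ is optional, i.e. for every non-negative $\mathcal{O} \otimes \mathcal{B}(\mathbb{R})$-measurable $W$ on $\Omega \times \mathbb{R}_+ \times \mathbb{R}$ the ($[0,\infty]$-valued) process $t \mapsto \int_{[0,t] \times \mathbb{R}} W(\omega,s,x)\, \mu(\omega, ds, dx)$ is optional; and $\mu$ is predictably $\sigma$-finite, i.e. there is a strictly positive $\mathcal{P} \otimes \mathcal{B}(\mathbb{R})$-measurable function $V$ on $\Omega \times \mathbb{R}_+ \times \mathbb{R}$ with $\mathbb{E}\left[\int_{\mathbb{R}_+ \times \mathbb{R}} V(\omega,s,x)\, \mu(\omega,ds,dx)\right] < \infty$. *)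

theory Defs
  imports "HOL-Probability.Probability"
begin

text \<open>
  The time set [0, infinity) is the subset \<open>{0..}\<close> of \<open>real\<close>. A process is a function
  \<open>'a \<Rightarrow> real \<Rightarrow> real\<close> and a filtration a function \<open>real \<Rightarrow> 'a measure\<close>; their values at negative
  times, and the values of processes outside \<open>space M\<close>, are never used. Of the measures \<open>F t\<close>
  only the \<open>\<sigma>\<close>-algebras matter.
\<close>

section \<open>Filtered probability spaces\<close>

locale filtered_prob_space = prob_space M for M :: "'a measure" +
  fixes F :: "real \<Rightarrow> 'a measure"
  assumes subalgebra_F: "\<And>t. 0 \<le> t \<Longrightarrow> subalgebra M (F t)"
    and sets_F_mono: "\<And>s t. 0 \<le> s \<Longrightarrow> s \<le> t \<Longrightarrow> sets (F s) \<subseteq> sets (F t)"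

text \<open>
  Completeness of \<open>M\<close> is not demanded: the null sets are the measurable ones. If \<open>M\<close> is complete,
  these are precisely the subsets of measurable null sets.
\<close>

definition usual_conditions :: "'a measure \<Rightarrow> (real \<Rightarrow> 'a measure) \<Rightarrow> bool" where
  "usual_conditions M F \<longleftrightarrow>
     null_sets M \<subseteq> sets (F 0) \<and>
     (\<forall>t\<ge>0. sets (F t) = (\<Inter>u\<in>{t<..}. sets (F u)))"

definition adapted :: "(real \<Rightarrow> 'a measure) \<Rightarrow> ('a \<Rightarrow> real \<Rightarrow> real) \<Rightarrow> bool" where
  "adapted F Y \<longleftrightarrow> (\<forall>t\<ge>0. (\<lambda>\<omega>. Y \<omega> t) \<in> borel_measurable (F t))"

section \<open>Path properties\<close>

definition cadlag :: "(real \<Rightarrow> real) \<Rightarrow> bool" where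
  "cadlag f \<longleftrightarrow>
     (\<forall>t\<ge>0. continuous (at_right t) f) \<and> (\<forall>t>0. \<exists>l. (f \<longlongrightarrow> l) (at_left t))"

definition left_continuous :: "(real \<Rightarrow> real) \<Rightarrow> bool" where
  "left_continuous f \<longleftrightarrow> (\<forall>t>0. continuous (at_left t) f)"

definition regulated :: "(real \<Rightarrow> real) \<Rightarrow> bool" where
  "regulated f \<longleftrightarrow>
     (\<forall>t>0. \<exists>l. (f \<longlongrightarrow> l) (at_left t)) \<and> (\<forall>t\<ge>0. \<exists>l. (f \<longlongrightarrow> l) (at_right t))"

definition right_limit :: "(real \<Rightarrow> real) \<Rightarrow> real \<Rightarrow> real" where
  "right_limit f t = Lim (at_right t) f"

definition left_limit :: "(real \<Rightarrow> real) \<Rightarrow> real \<Rightarrow> real" where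
  "left_limit f t = (if t = 0 then right_limit f 0 else Lim (at_left t) f)"

text \<open>The jump compares the two one-sided limits; the value of \<open>f\<close> at \<open>t\<close> itself plays no role.\<close>

definition jump :: "(real \<Rightarrow> real) \<Rightarrow> real \<Rightarrow> real" where
  "jump f t = right_limit f t - left_limit f t"

section \<open>Optional and predictable \<open>\<sigma>\<close>-algebras\<close>

definition generated_by_processes :: "'a measure \<Rightarrow> ('a \<Rightarrow> real \<Rightarrow> real) set \<Rightarrow> ('a \<times> real) measure"
where
  "generated_by_processes M \<Y> =
     sigma (space M \<times> {0..})
       {(\<lambda>(\<omega>, t). Y \<omega> t) -` B \<inter> (space M \<times> {0..}) | Y B. Y \<in> \<Y> \<and> B \<in> sets borel}"

definition optional_sigma :: "'a measure \<Rightarrow> (real \<Rightarrow> 'a measure) \<Rightarrow> ('a \<times> real) measure" where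
  "optional_sigma M F =
     generated_by_processes M {Y. adapted F Y \<and> (\<forall>\<omega>\<in>space M. cadlag (Y \<omega>))}"

definition predictable_sigma :: "'a measure \<Rightarrow> (real \<Rightarrow> 'a measure) \<Rightarrow> ('a \<times> real) measure" where
  "predictable_sigma M F =
     generated_by_processes M {Y. adapted F Y \<and> (\<forall>\<omega>\<in>space M. left_continuous (Y \<omega>))}"

section \<open>Integer-valued random measures\<close>

abbreviation mark_space :: "(real \<times> real) measure" where
  "mark_space \<equiv> restrict_space borel {0..} \<Otimes>\<^sub>M borel"

text \<open>
  A random measure is a family of set functions \<open>\<mu> \<omega>\<close>, of which only the values on
  \<open>sets mark_space\<close> matter; \<open>path_measure \<mu> \<omega>\<close> bundles \<open>\<mu> \<omega>\<close> into a measure, with respect to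
  which one can integrate.
\<close>

definition path_measure :: "('a \<Rightarrow> (real \<times> real) set \<Rightarrow> ennreal) \<Rightarrow> 'a \<Rightarrow> (real \<times> real) measure"
where
  "path_measure \<mu> \<omega> = measure_of (space mark_space) (sets mark_space) (\<mu> \<omega>)"

definition optional_random_measure ::
  "'a measure \<Rightarrow> (real \<Rightarrow> 'a measure) \<Rightarrow> ('a \<Rightarrow> (real \<times> real) set \<Rightarrow> ennreal) \<Rightarrow> bool" where
  "optional_random_measure M F \<mu> \<longleftrightarrow>
     (\<forall>W :: ('a \<times> real) \<times> real \<Rightarrow> ennreal.
        W \<in> borel_measurable (optional_sigma M F \<Otimes>\<^sub>M borel) \<longrightarrow>
        (\<lambda>(\<omega>, t). \<integral>\<^sup>+z\<in>{0..t} \<times> UNIV. W ((\<omega>, fst z), snd z) \<partial>path_measure \<mu> \<omega>)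
          \<in> borel_measurable (optional_sigma M F))"

definition predictably_sigma_finite ::
  "'a measure \<Rightarrow> (real \<Rightarrow> 'a measure) \<Rightarrow> ('a \<Rightarrow> (real \<times> real) set \<Rightarrow> ennreal) \<Rightarrow> bool" where
  "predictably_sigma_finite M F \<mu> \<longleftrightarrow>
     (\<exists>V :: ('a \<times> real) \<times> real \<Rightarrow> real.
        V \<in> borel_measurable (predictable_sigma M F \<Otimes>\<^sub>M borel) \<and>
        (\<forall>\<omega>\<in>space M. \<forall>s\<ge>0. \<forall>x. 0 < V ((\<omega>, s), x)) \<and>
        (\<integral>\<^sup>+\<omega>. (\<integral>\<^sup>+z. ennreal (V ((\<omega>, fst z), snd z)) \<partial>path_measure \<mu> \<omega>) \<partial>M) < \<infinity>)"

definition integer_valued_random_measure ::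
  "'a measure \<Rightarrow> (real \<Rightarrow> 'a measure) \<Rightarrow> ('a \<Rightarrow> (real \<times> real) set \<Rightarrow> ennreal) \<Rightarrow> bool" where
  "integer_valued_random_measure M F \<mu> \<longleftrightarrow>
     (\<forall>\<omega>\<in>space M. measure_space (space mark_space) (sets mark_space) (\<mu> \<omega>)) \<and>
     (\<forall>\<omega>\<in>space M. \<mu> \<omega> ({0} \<times> UNIV) = 0) \<and>
     (\<forall>G\<in>sets mark_space. (\<lambda>\<omega>. \<mu> \<omega> G) \<in> borel_measurable M) \<and>
     (\<forall>G\<in>sets mark_space. \<forall>\<omega>\<in>space M. \<mu> \<omega> G \<in> range of_nat \<union> {\<infinity>}) \<and>
     (\<forall>\<omega>\<in>space M. \<forall>t\<ge>0. \<mu> \<omega> ({t} \<times> UNIV) \<le> 1) \<and>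
     optional_random_measure M F \<mu> \<and>
     predictably_sigma_finite M F \<mu>"

section \<open>The jump measure\<close>

definition unordered_sum :: "('b \<Rightarrow> ennreal) \<Rightarrow> 'b set \<Rightarrow> ennreal" where
  "unordered_sum h L = (SUP A\<in>{A. finite A \<and> A \<subseteq> L}. \<Sum>s\<in>A. h s)"

definition jump_set :: "'a measure \<Rightarrow> ('a \<Rightarrow> real \<Rightarrow> real) \<Rightarrow> ('a \<times> real) set" where
  "jump_set M X = {(\<omega>, s) \<in> space M \<times> {0..}. jump (X \<omega>) s \<noteq> 0}"

definition jump_measure ::
  "'a measure \<Rightarrow> ('a \<Rightarrow> real \<Rightarrow> real) \<Rightarrow> 'a \<Rightarrow> (real \<times> real) set \<Rightarrow> ennreal" where
  "jump_measure M X \<omega> G =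
     unordered_sum (\<lambda>s. indicator G (s, jump (X \<omega>) s) * indicator (jump_set M X) (\<omega>, s)) {0<..}"

end

theory Submission
  imports Defs
begin

text \<open>
  A jump of \<open>X\<close> compares one-sided limits only, so \<open>X\<close> can be replaced by its right-limit process
  \<open>Y\<close>, which has the same jumps, is cadlag, and is adapted because the filtration is
  right-continuous. For every \<open>e > 0\<close> the times at which a cadlag path jumps by more than \<open>e\<close>
  have no finite accumulation point, and the jump times are the increasing union of these locally
  finite sets along \<open>e = 1 / Suc k\<close>. On each path the jump measure is the image of counting
  measure on the jump times under \<open>s \<mapsto> (s, \<Delta>Y\<^sub>s)\<close>; this settles all pathwise requirements.

  Measurability rests on one observation, \<open>large_jump_iff_sampling\<close>: whether \<open>Y\<close> has a jump larger
  than \<open>e\<close> in \<open>(c, u]\<close> can be read off the values of \<open>Y\<close> at \<open>u\<close> and at rational times in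
  \<open>(c, u]\<close>. It follows that the first large jump time in an interval \<open>(c, d]\<close> is known at time \<open>d\<close>. For an optional \<open>g\<close>
  vanishing outside the large jumps, the sum of \<open>g\<close> over the large jumps up to \<open>t\<close> is the limit,
  over partitions of \<open>(0, t]\<close> with mesh tending to \<open>0\<close>, of the sums of \<open>g\<close> at the first large jump
  in each cell. So this sum is adapted; as a function of \<open>t\<close> it is a cadlag step function; hence it
  is an optional process (\<open>optional_sum_large_jumps\<close>). The integral process of a general
  \<open>W\<close> is an increasing limit of such sums, obtained by truncating \<open>W\<close> at \<open>k\<close> and restricting
  to jumps larger than \<open>1 / Suc k\<close>.

  For predictable sigma-finiteness, give a jump of size \<open>x\<close> at time \<open>s\<close> the weight
  \<open>\<Sum>k. 2 ^ (- k) * 2 ^ (- N\<^sub>k s) * 1 {1 / Suc k < \<bar>x\<bar>}\<close>, where \<open>N\<^sub>k s\<close> counts the jumps larger than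
  \<open>1 / Suc k\<close> strictly before \<open>s\<close>. The process \<open>N\<^sub>k\<close> is left-continuous and adapted, so the weight is
  predictable. It is positive whenever \<open>x \<noteq> 0\<close>, and since \<open>N\<^sub>k\<close> takes different values at different
  jumps of level \<open>k\<close>, each level contributes at most \<open>2 ^ (- k) * 2\<close> on every path; the integral of
  the weight is bounded by \<open>4\<close>.
\<close>

section \<open>Jumps of regulated functions\<close>

lemma regulated_tendsto_right:
  assumes "regulated f" "0 \<le> t"
  shows "(f \<longlongrightarrow> right_limit f t) (at_right t)"
proof -
  obtain l where "(f \<longlongrightarrow> l) (at_right t)"
    using assms by (auto simp: regulated_def)
  then show ?thesis
    unfolding right_limit_def using tendsto_Lim[OF trivial_limit_at_right_real] by metis
qed

lemma regulated_tendsto_left: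
  assumes "regulated f" "0 < t"
  shows "(f \<longlongrightarrow> left_limit f t) (at_left t)"
proof -
  obtain l where "(f \<longlongrightarrow> l) (at_left t)"
    using assms by (auto simp: regulated_def)
  then show ?thesis
    unfolding left_limit_def using tendsto_Lim[OF trivial_limit_at_left_real] assms(2)
    by (metis less_irrefl)
qed

lemma cadlag_imp_regulated: "cadlag f \<Longrightarrow> regulated f"
  unfolding cadlag_def regulated_def continuous_within by blast

lemma cadlag_right_limit:
  assumes "cadlag f" "0 \<le> t"
  shows "right_limit f t = f t"
  using assms tendsto_Lim[OF trivial_limit_at_right_real, of f "f t" t]
  unfolding cadlag_def continuous_within right_limit_def by blast

lemma jump_at_0: "jump f 0 = 0"
  by (simp add: jump_def left_limit_def)

lemma one_sided_limits_near:
  assumes "regulated f" "0 \<le> a" "x \<in> {a<..<b}"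
    and near: "\<And>y. y \<in> {a<..<b} \<Longrightarrow> dist (f y) l \<le> e"
  shows "dist (right_limit f x) l \<le> e" "dist (left_limit f x) l \<le> e"
proof -
  have "eventually (\<lambda>y. dist (f y) l \<le> e) (at_right x)"
    using assms(3) near unfolding eventually_at_right_field by (intro exI[of _ b]) auto
  then show "dist (right_limit f x) l \<le> e"
    using assms(1-3)
    by (intro tendsto_upperbound[OF tendsto_dist[OF regulated_tendsto_right tendsto_const]]) auto
  have "eventually (\<lambda>y. dist (f y) l \<le> e) (at_left x)"
    using assms(3) near unfolding eventually_at_left_field by (intro exI[of _ a]) auto
  then show "dist (left_limit f x) l \<le> e"
    using assms(1-3)
    by (intro tendsto_upperbound[OF tendsto_dist[OF regulated_tendsto_left tendsto_const]]) auto
qed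

lemma one_sided_limits_eventually_right:
  assumes "regulated f" "0 \<le> t" "0 < e"
  shows "eventually (\<lambda>x. dist (right_limit f x) (right_limit f t) \<le> e \<and>
           dist (left_limit f x) (right_limit f t) \<le> e) (at_right t)"
proof -
  have "eventually (\<lambda>x. dist (f x) (right_limit f t) < e) (at_right t)"
    using tendstoD[OF regulated_tendsto_right[OF assms(1,2)] assms(3)] .
  then obtain b where "t < b" and b: "\<And>y. t < y \<Longrightarrow> y < b \<Longrightarrow> dist (f y) (right_limit f t) < e"
    unfolding eventually_at_right_field by blast
  have near: "dist (f y) (right_limit f t) \<le> e" if "y \<in> {t<..<b}" for y
    using b[of y] that by simp
  show ?thesis
    unfolding eventually_at_right_field
    using \<open>t < b\<close> one_sided_limits_near[OF assms(1,2), of _ b, OF _ near]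
    by (intro exI[of _ b]) auto
qed

lemma one_sided_limits_eventually_left:
  assumes "regulated f" "0 < t" "0 < e"
  shows "eventually (\<lambda>x. dist (right_limit f x) (left_limit f t) \<le> e \<and>
           dist (left_limit f x) (left_limit f t) \<le> e) (at_left t)"
proof -
  have "eventually (\<lambda>x. dist (f x) (left_limit f t) < e) (at_left t)"
    using tendstoD[OF regulated_tendsto_left[OF assms(1,2)] assms(3)] .
  then obtain a where "a < t" and a: "\<And>y. a < y \<Longrightarrow> y < t \<Longrightarrow> dist (f y) (left_limit f t) < e"
    unfolding eventually_at_left_field by blast
  have near: "dist (f y) (left_limit f t) \<le> e" if "y \<in> {max 0 a<..<t}" for y
    using a[of y] that by simp
  show ?thesis
    unfolding eventually_at_left_field
    using \<open>a < t\<close> \<open>0 < t\<close> one_sided_limits_near[OF assms(1), of "max 0 a" _ t, OF _ _ near]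
    by (intro exI[of _ "max 0 a"]) auto
qed

lemma right_limit_tendsto_right:
  assumes "regulated f" "0 \<le> t"
  shows "(right_limit f \<longlongrightarrow> right_limit f t) (at_right t)"
proof (rule tendstoI)
  fix e :: real assume "0 < e"
  then show "eventually (\<lambda>x. dist (right_limit f x) (right_limit f t) < e) (at_right t)"
    using one_sided_limits_eventually_right[OF assms, of "e / 2"]
    by (auto elim!: eventually_mono)
qed

lemma right_limit_tendsto_left:
  assumes "regulated f" "0 < t"
  shows "(right_limit f \<longlongrightarrow> left_limit f t) (at_left t)"
proof (rule tendstoI)
  fix e :: real assume "0 < e"
  then show "eventually (\<lambda>x. dist (right_limit f x) (left_limit f t) < e) (at_left t)"
    using one_sided_limits_eventually_left[OF assms, of "e / 2"]
    by (auto elim!: eventually_mono)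
qed

lemma cadlag_right_limit_function:
  assumes "regulated f"
  shows "cadlag (right_limit f)"
  using right_limit_tendsto_right[OF assms] right_limit_tendsto_left[OF assms]
  unfolding cadlag_def continuous_within by blast

text \<open>
  Both one-sided limits of \<open>f\<close> at a point are unchanged when \<open>f\<close> is replaced by its right-limit
  function. This is what reduces jumps of regulated functions to jumps of cadlag functions.
\<close>

lemma jump_right_limit_function:
  assumes "regulated f" "0 \<le> t"
  shows "jump (right_limit f) t = jump f t"
proof (cases "t = 0")
  case False
  with assms have "0 < t" by simp
  have "right_limit (right_limit f) t = right_limit f t"
    using cadlag_right_limit[OF cadlag_right_limit_function[OF assms(1)] assms(2)] .
  moreover have "left_limit (right_limit f) t = left_limit f t"
    using tendsto_Lim[OF trivial_limit_at_left_real right_limit_tendsto_left[OF assms(1) \<open>0 < t\<close>]]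
      False by (simp add: left_limit_def)
  ultimately show ?thesis
    by (simp add: jump_def)
qed (simp add: jump_at_0)

definition large_jumps :: "(real \<Rightarrow> real) \<Rightarrow> real \<Rightarrow> real set" where
  "large_jumps f e = {s. 0 < s \<and> e < \<bar>jump f s\<bar>}"

lemma not_large_jump:
  assumes "dist (right_limit f s) l \<le> e / 2" "dist (left_limit f s) l \<le> e / 2"
  shows "s \<notin> large_jumps f e"
proof -
  have "\<bar>jump f s\<bar> \<le> e"
    using assms unfolding jump_def dist_real_def by arith
  then show ?thesis
    by (simp add: large_jumps_def)
qed

text \<open>
  Close to \<open>t\<close>, on either side, all values of \<open>f\<close> lie close to the one-sided limit at \<open>t\<close>, hence so
  do both one-sided limits at nearby points: large jumps do not accumulate.
\<close>

lemma no_large_jumps_right: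
  assumes "regulated f" "0 \<le> t" "0 < e"
  shows "eventually (\<lambda>s. s \<notin> large_jumps f e) (at_right t)"
  by (rule eventually_mono[OF one_sided_limits_eventually_right[OF assms(1,2), of "e / 2"]])
     (use assms(3) in \<open>auto dest: not_large_jump simp del: le_divide_eq_numeral1\<close>)

lemma no_large_jumps_left:
  assumes "regulated f" "0 \<le> t" "0 < e"
  shows "eventually (\<lambda>s. s \<notin> large_jumps f e) (at_left t)"
proof (cases "t = 0")
  case True
  then show ?thesis
    by (auto simp: eventually_at_left_field large_jumps_def intro!: exI[of _ "-1"])
next
  case False
  then show ?thesis
    by (intro eventually_mono[OF one_sided_limits_eventually_left[OF assms(1), of t "e / 2"]])
       (use assms(2,3) in \<open>auto dest: not_large_jump simp del: le_divide_eq_numeral1\<close>)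
qed

lemma finite_large_jumps:
  assumes "regulated f" "0 < e"
  shows "finite (large_jumps f e \<inter> {..t})"
proof (rule ccontr)
  let ?A = "large_jumps f e \<inter> {..t}"
  assume "infinite ?A"
  moreover have "?A \<subseteq> {0..t}"
    by (auto simp: large_jumps_def)
  ultimately obtain l where l: "l \<in> {0..t}" "l islimpt ?A"
    using compact_Icc[of 0 t] unfolding compact_eq_Bolzano_Weierstrass by blast
  have "eventually (\<lambda>s. s \<notin> large_jumps f e) (at l)"
    using no_large_jumps_left[OF assms(1) _ assms(2), of l]
      no_large_jumps_right[OF assms(1) _ assms(2), of l] l(1)
    by (simp add: eventually_at_split)
  then have "eventually (\<lambda>s. s \<notin> ?A) (at l)"
    by (auto elim!: eventually_mono)
  then show False
    using l(2) by (simp add: islimpt_iff_eventually)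
qed

text \<open>
  To the right of \<open>t\<close> no large jump is added for a while, and to the left of \<open>t\<close> the large jumps
  up to \<open>y\<close> are soon all those before \<open>t\<close>. Hence functionals of the large jumps up to time \<open>t\<close> are
  step functions of \<open>t\<close>.
\<close>

lemma large_jumps_eventually_right:
  assumes "regulated f" "0 \<le> t" "0 < e"
  shows "eventually (\<lambda>y. large_jumps f e \<inter> {..y} = large_jumps f e \<inter> {..t}) (at_right t)"
proof -
  obtain b where "t < b" and b: "\<And>y. t < y \<Longrightarrow> y < b \<Longrightarrow> y \<notin> large_jumps f e"
    using no_large_jumps_right[OF assms] unfolding eventually_at_right_field by blast
  have "large_jumps f e \<inter> {..y} = large_jumps f e \<inter> {..t}" if "t < y" "y < b" for y
  proof safe
    fix s assume "s \<in> large_jumps f e" "s \<le> y"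
    then show "s \<le> t" using b[of s] that by (cases "s \<le> t") auto
  qed (use that in auto)
  with \<open>t < b\<close> show ?thesis
    unfolding eventually_at_right_field by blast
qed

lemma large_jumps_eventually_left:
  assumes "regulated f" "0 \<le> t" "0 < e"
  shows "eventually (\<lambda>y. large_jumps f e \<inter> {..y} = large_jumps f e \<inter> {..<t} \<and>
           large_jumps f e \<inter> {..<y} = large_jumps f e \<inter> {..<t}) (at_left t)"
proof -
  obtain a where "a < t" and a: "\<And>y. a < y \<Longrightarrow> y < t \<Longrightarrow> y \<notin> large_jumps f e"
    using no_large_jumps_left[OF assms] unfolding eventually_at_left_field by blast
  have "s < y" if "a < y" "y < t" "s \<in> large_jumps f e" "s < t" for s y
    using a[of s] that by (cases "s < y") auto
  then have "large_jumps f e \<inter> {..y} = large_jumps f e \<inter> {..<t} \<and>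
      large_jumps f e \<inter> {..<y} = large_jumps f e \<inter> {..<t}" if "a < y" "y < t" for y
    using that by (auto intro: less_imp_le)
  with \<open>a < t\<close> show ?thesis
    unfolding eventually_at_left_field by blast
qed

lemma cadlag_sum_large_jumps:
  assumes "regulated f" "0 < e"
  shows "cadlag (\<lambda>t. \<Sum>s\<in>large_jumps f e \<inter> {..t}. g s)"
  unfolding cadlag_def continuous_within
proof (intro conjI allI impI)
  fix t :: real assume "0 \<le> t"
  show "((\<lambda>t. \<Sum>s\<in>large_jumps f e \<inter> {..t}. g s) \<longlongrightarrow> (\<Sum>s\<in>large_jumps f e \<inter> {..t}. g s)) (at_right t)"
    by (rule tendsto_eventually, rule eventually_mono[OF large_jumps_eventually_right[OF assms(1) \<open>0 \<le> t\<close> assms(2)]])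
       (simp only:)
next
  fix t :: real assume "0 < t"
  have "((\<lambda>t. \<Sum>s\<in>large_jumps f e \<inter> {..t}. g s) \<longlongrightarrow> (\<Sum>s\<in>large_jumps f e \<inter> {..<t}. g s)) (at_left t)"
    by (rule tendsto_eventually, rule eventually_mono[OF large_jumps_eventually_left[OF assms(1) less_imp_le[OF \<open>0 < t\<close>] assms(2)]])
       (elim conjE, simp only:)
  then show "\<exists>l. ((\<lambda>t. \<Sum>s\<in>large_jumps f e \<inter> {..t}. g s) \<longlongrightarrow> l) (at_left t)" ..
qed

lemma left_continuous_large_jumps_before:
  fixes h :: "real set \<Rightarrow> real"
  assumes "regulated f" "0 < e"
  shows "left_continuous (\<lambda>t. h (large_jumps f e \<inter> {..<t}))"
  unfolding left_continuous_def continuous_within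
proof (intro allI impI)
  fix t :: real assume "0 < t"
  show "((\<lambda>t. h (large_jumps f e \<inter> {..<t})) \<longlongrightarrow> h (large_jumps f e \<inter> {..<t})) (at_left t)"
    by (rule tendsto_eventually, rule eventually_mono[OF large_jumps_eventually_left[OF assms(1) less_imp_le[OF \<open>0 < t\<close>] assms(2)]])
       (elim conjE, simp only:)
qed

text \<open>
  For a nondecreasing time change \<open>\<phi>\<close>, the values \<open>\<phi> y\<close> for \<open>y < t\<close> either stay below \<open>\<phi> t\<close>
  or are equal to it from some point on; in the first case \<open>f \<circ> \<phi>\<close> inherits the left limit of \<open>f\<close>
  at \<open>\<phi> t\<close>, in the second it is constant just before \<open>t\<close>.
\<close>

lemma cadlag_compose_mono:
  assumes f: "cadlag f" and \<phi>: "mono \<phi>" "continuous_on UNIV \<phi>" "\<And>t. 0 \<le> t \<Longrightarrow> 0 \<le> \<phi> t"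
  shows "cadlag (\<lambda>t. f (\<phi> t))"
  unfolding cadlag_def
proof (intro conjI allI impI)
  have lim: "(\<phi> \<longlongrightarrow> \<phi> t) (at t within S)" for t S
    by (rule tendsto_within_subset[OF _ subset_UNIV]) (use \<phi>(2) in \<open>simp add: continuous_on_def\<close>)
  { fix t :: real assume "0 \<le> t"
    have "continuous (at (\<phi> t) within {\<phi> t..}) f"
      using f \<phi>(3)[OF \<open>0 \<le> t\<close>] unfolding cadlag_def continuous_within
      by (simp add: at_within_Ici_at_right)
    then have "continuous (at (\<phi> t) within \<phi> ` {t<..}) f"
      by (rule continuous_within_subset) (auto intro: monoD[OF \<phi>(1)])
    then show "continuous (at_right t) (\<lambda>t. f (\<phi> t))"
      by (rule continuous_within_compose2[rotated]) (simp add: continuous_within lim)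
  }
  fix t :: real assume "0 < t"
  show "\<exists>l. ((\<lambda>t. f (\<phi> t)) \<longlongrightarrow> l) (at_left t)"
  proof (cases "\<exists>y<t. \<phi> y = \<phi> t")
    case True
    then obtain y where y: "y < t" "\<phi> y = \<phi> t" by blast
    have "\<phi> z = \<phi> t" if "y < z" "z < t" for z
      using monoD[OF \<phi>(1), of y z] monoD[OF \<phi>(1), of z t] y that by simp
    then have "eventually (\<lambda>z. f (\<phi> z) = f (\<phi> t)) (at_left t)"
      unfolding eventually_at_left_field using y(1) by (intro exI[of _ y]) auto
    then show ?thesis
      by (intro exI[of _ "f (\<phi> t)"] tendsto_eventually)
  next
    case False
    then have less: "\<phi> y < \<phi> t" if "y < t" for y
      using monoD[OF \<phi>(1), of y t] that by (auto simp: less_le)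
    have "0 < \<phi> t"
      using less[OF \<open>0 < t\<close>] \<phi>(3)[of 0] by simp
    then obtain l where l: "(f \<longlongrightarrow> l) (at_left (\<phi> t))"
      using f unfolding cadlag_def by blast
    have "filterlim \<phi> (at_left (\<phi> t)) (at_left t)"
      by (rule tendsto_imp_filterlim_at_left[OF lim])
         (use less in \<open>auto simp: eventually_at_left_field intro!: exI[of _ "t - 1"]\<close>)
    then show ?thesis
      using filterlim_compose[OF l] by blast
  qed
qed

lemma left_limit_sequentially:
  assumes "cadlag f" "0 \<le> t"
  shows "(\<lambda>n. f (max 0 (t - 1 / real (Suc n)))) \<longlonglongrightarrow> left_limit f t"
proof (cases "t = 0")
  case True
  have "max 0 (t - 1 / real (Suc n)) = 0" for n
    using True by simp
  then show ?thesis
    using True cadlag_right_limit[OF assms(1), of 0] by (simp add: left_limit_def)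
next
  case False
  with assms have "0 < t" by simp
  have "(\<lambda>n. max 0 (t - 1 / real (Suc n))) \<longlonglongrightarrow> max 0 (t - 0)"
    by (rule tendsto_max[OF tendsto_const tendsto_diff[OF tendsto_const LIMSEQ_Suc[OF lim_1_over_n]]])
  then have "(\<lambda>n. max 0 (t - 1 / real (Suc n))) \<longlonglongrightarrow> t"
    using \<open>0 < t\<close> by simp
  then have "filterlim (\<lambda>n. max 0 (t - 1 / real (Suc n))) (at_left t) sequentially"
    by (rule tendsto_imp_filterlim_at_left) (use \<open>0 < t\<close> in auto)
  then show ?thesis
    using filterlim_compose[OF regulated_tendsto_left[OF cadlag_imp_regulated[OF assms(1)] \<open>0 < t\<close>]]
    by blast
qed

section \<open>Detecting large jumps at rational times\<close>

text \<open>
  On the left of \<open>s\<close> the function is nearly constant, and on the right of \<open>s\<close>, including \<open>s\<close>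
  itself, as well. For the second half right-continuity is needed: a merely regulated function
  could take a value at \<open>s\<close> that has nothing to do with its one-sided limits.
\<close>

lemma cadlag_oscillation_near:
  assumes "cadlag f" "0 < s" "0 < e"
  obtains d where "0 < d"
    "\<And>p q. \<bar>p - s\<bar> < d \<Longrightarrow> \<bar>q - s\<bar> < d \<Longrightarrow> \<bar>f p - f q\<bar> \<le> \<bar>jump f s\<bar> + 2 * e"
proof -
  note reg = cadlag_imp_regulated[OF assms(1)]
  have fs: "right_limit f s = f s"
    using cadlag_right_limit[OF assms(1)] assms(2) by simp
  obtain a where "a < s" and a: "\<And>y. a < y \<Longrightarrow> y < s \<Longrightarrow> dist (f y) (left_limit f s) < e"
    using tendstoD[OF regulated_tendsto_left[OF reg assms(2)] assms(3)]
    unfolding eventually_at_left_field by blast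
  obtain b where "s < b" and b: "\<And>y. s < y \<Longrightarrow> y < b \<Longrightarrow> dist (f y) (f s) < e"
    using tendstoD[OF regulated_tendsto_right[OF reg less_imp_le[OF assms(2)]] assms(3)] fs
    unfolding eventually_at_right_field by metis
  have cases: "\<bar>f p - left_limit f s\<bar> < e \<or> \<bar>f p - f s\<bar> < e" if "\<bar>p - s\<bar> < min (s - a) (b - s)" for p
  proof -
    consider "p < s" | "p = s" | "s < p" by linarith
    then show ?thesis
      by cases (use that a[of p] b[of p] assms(3) in \<open>auto simp: dist_real_def\<close>)
  qed
  show ?thesis
  proof (rule that)
    show "0 < min (s - a) (b - s)"
      using \<open>a < s\<close> \<open>s < b\<close> by simp
    fix p q assume "\<bar>p - s\<bar> < min (s - a) (b - s)" "\<bar>q - s\<bar> < min (s - a) (b - s)"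
    from cases[OF this(1)] cases[OF this(2)] show "\<bar>f p - f q\<bar> \<le> \<bar>jump f s\<bar> + 2 * e"
      unfolding jump_def fs by arith
  qed
qed

text \<open>
  The end point \<open>u\<close> joins the rationals because a jump at \<open>u\<close> itself must be seen without looking
  beyond \<open>u\<close>.
\<close>

definition sampling_pairs :: "real \<Rightarrow> real \<Rightarrow> nat \<Rightarrow> nat \<Rightarrow> (real \<times> real) set" where
  "sampling_pairs c u m n =
     {(p, q) \<in> insert u \<rat> \<times> insert u \<rat>.
        p \<in> {c + 1 / real (Suc m)..u} \<and> q \<in> {c + 1 / real (Suc m)..u} \<and> \<bar>p - q\<bar> < 1 / real (Suc n)}"

lemma countable_sampling_pairs: "countable (sampling_pairs c u m n)"
proof (rule countable_subset)
  show "sampling_pairs c u m n \<subseteq> insert u \<rat> \<times> insert u \<rat>"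
    by (auto simp: sampling_pairs_def)
qed (intro countable_SIGMA countable_insert countable_rat)

text \<open>
  Points on the two sides of a large jump, arbitrarily close to each other, differ in value by
  more than \<open>e\<close>. Conversely, closer and closer pairs whose values differ by more than
  \<open>e + 1 / Suc m\<close> accumulate, by compactness, at some point, and this point must carry a jump of size greater than \<open>e\<close>. The
  margin \<open>1 / Suc m\<close> keeps this strict, and keeps the accumulation point away from the excluded
  end point \<open>c\<close>.
\<close>

lemma large_jump_iff_sampling:
  assumes f: "cadlag f" and "0 \<le> c" "0 < e"
  shows "(\<exists>s\<in>large_jumps f e. c < s \<and> s \<le> u) \<longleftrightarrow>
    (\<exists>m. \<forall>n. \<exists>(p, q)\<in>sampling_pairs c u m n. e + 1 / real (Suc m) < \<bar>f p - f q\<bar>)"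
    (is "?L \<longleftrightarrow> ?R")
proof
  assume ?L
  then obtain s where s: "e < \<bar>jump f s\<bar>" "c < s" "s \<le> u" "0 < s"
    by (auto simp: large_jumps_def)
  note reg = cadlag_imp_regulated[OF f]
  have fs: "right_limit f s = f s"
    using cadlag_right_limit[OF f] s by simp
  obtain m where m: "inverse (real (Suc m)) < min (\<bar>jump f s\<bar> - e) (s - c)"
    using reals_Archimedean[of "min (\<bar>jump f s\<bar> - e) (s - c)"] s by auto
  define \<eta> where "\<eta> = (\<bar>jump f s\<bar> - e - 1 / real (Suc m)) / 2"
  have "0 < \<eta>"
    using m by (simp add: \<eta>_def inverse_eq_divide)
  have m': "c + 1 / real (Suc m) < s"
    using m by (simp add: inverse_eq_divide)
  show ?R
  proof (intro exI allI)
    fix n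
    define d where "d = 1 / real (Suc n) / 2"
    have "0 < d" by (simp add: d_def)
    obtain a where "a < s" and a: "\<And>y. a < y \<Longrightarrow> y < s \<Longrightarrow> dist (f y) (left_limit f s) < \<eta>"
      using tendstoD[OF regulated_tendsto_left[OF reg \<open>0 < s\<close>] \<open>0 < \<eta>\<close>]
      unfolding eventually_at_left_field by blast
    obtain p where p: "p \<in> \<rat>" "max a (max (s - d) (c + 1 / real (Suc m))) < p" "p < s"
      using Rats_dense_in_real[of "max a (max (s - d) (c + 1 / real (Suc m)))" s]
        \<open>a < s\<close> \<open>0 < d\<close> m' by auto
    have "\<exists>q\<in>insert u \<rat>. s \<le> q \<and> q \<le> u \<and> q < s + d \<and> dist (f q) (f s) < \<eta>"
    proof (cases "s = u")
      case True
      then show ?thesis using \<open>0 < d\<close> \<open>0 < \<eta>\<close> by auto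
    next
      case False
      obtain b where "s < b" and b: "\<And>y. s < y \<Longrightarrow> y < b \<Longrightarrow> dist (f y) (f s) < \<eta>"
        using tendstoD[OF regulated_tendsto_right[OF reg less_imp_le[OF \<open>0 < s\<close>]] \<open>0 < \<eta>\<close>] fs
        unfolding eventually_at_right_field by metis
      obtain q where "q \<in> \<rat>" "s < q" "q < min b (min u (s + d))"
        using Rats_dense_in_real[of s "min b (min u (s + d))"]
          \<open>s < b\<close> \<open>0 < d\<close> False \<open>s \<le> u\<close> by auto
      then show ?thesis
        using b[of q] by (intro bexI[of _ q]) auto
    qed
    then obtain q where q: "q \<in> insert u \<rat>" "s \<le> q" "q \<le> u" "q < s + d" "dist (f q) (f s) < \<eta>"
      by blast
    have "\<bar>p - q\<bar> < 2 * d"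
      using p q by auto
    moreover have "2 * d = 1 / real (Suc n)"
      unfolding d_def by (simp only: mult_2 field_sum_of_halves)
    ultimately have "\<bar>p - q\<bar> < 1 / real (Suc n)"
      by simp
    then have "(p, q) \<in> sampling_pairs c u m n"
      using p q m' s by (auto simp: sampling_pairs_def)
    moreover have "e + 1 / real (Suc m) < \<bar>f p - f q\<bar>"
    proof -
      have "\<bar>f p - left_limit f s\<bar> < \<eta>"
        using a[of p] p by (simp add: dist_real_def)
      moreover have "\<bar>f q - f s\<bar> < \<eta>"
        using q by (simp add: dist_real_def)
      moreover have "\<bar>jump f s\<bar> = e + 1 / real (Suc m) + 2 * \<eta>"
        unfolding \<eta>_def by (simp only: mult_2 field_sum_of_halves)
      ultimately show ?thesis
        unfolding jump_def fs by arith
    qed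
    ultimately show "\<exists>(p, q)\<in>sampling_pairs c u m n. e + 1 / real (Suc m) < \<bar>f p - f q\<bar>"
      by blast
  qed
next
  assume ?R
  then obtain m where "\<forall>n. \<exists>z\<in>sampling_pairs c u m n. e + 1 / real (Suc m) < \<bar>f (fst z) - f (snd z)\<bar>"
    by (auto simp: case_prod_unfold)
  then obtain z where z: "\<And>n. z n \<in> sampling_pairs c u m n"
      "\<And>n. e + 1 / real (Suc m) < \<bar>f (fst (z n)) - f (snd (z n))\<bar>"
    by metis
  define p q where "p n = fst (z n)" and "q n = snd (z n)" for n
  let ?c = "c + 1 / real (Suc m)"
  have p: "p n \<in> {?c..u}" and pq: "\<bar>p n - q n\<bar> < 1 / real (Suc n)"
    and gap: "e + 1 / real (Suc m) < \<bar>f (p n) - f (q n)\<bar>" for n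
    using z[of n] by (auto simp: p_def q_def sampling_pairs_def case_prod_unfold)
  obtain s r where s: "s \<in> {?c..u}" and r: "strict_mono r" and lim_p: "(p \<circ> r) \<longlonglongrightarrow> s"
    using compact_imp_seq_compact[OF compact_Icc[of ?c u]] p unfolding seq_compact_def by metis
  have "(\<lambda>n. p n - q n) \<longlonglongrightarrow> 0"
    by (rule Lim_null_comparison[OF _ LIMSEQ_Suc[OF lim_1_over_n]])
       (use pq in \<open>auto intro!: always_eventually less_imp_le\<close>)
  then have "((\<lambda>n. p n - q n) \<circ> r) \<longlonglongrightarrow> 0"
    using r by (rule LIMSEQ_subseq_LIMSEQ)
  from tendsto_diff[OF lim_p this] have lim_q: "(q \<circ> r) \<longlonglongrightarrow> s"
    by (simp add: o_def)
  have "c < s"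
    using s by (smt (verit) atLeastAtMost_iff divide_pos_pos of_nat_0_less_iff zero_less_Suc)
  then have "0 < s" using \<open>0 \<le> c\<close> by simp
  obtain d where "0 < d" and
    d: "\<And>p q. \<bar>p - s\<bar> < d \<Longrightarrow> \<bar>q - s\<bar> < d \<Longrightarrow> \<bar>f p - f q\<bar> \<le> \<bar>jump f s\<bar> + 1 / real (Suc m)"
    using cadlag_oscillation_near[OF f \<open>0 < s\<close>, of "1 / real (Suc m) / 2"]
    unfolding mult_2 field_sum_of_halves by (metis half_gt_zero of_nat_0_less_iff zero_less_Suc zero_less_divide_1_iff)
  have "eventually (\<lambda>n. dist ((p \<circ> r) n) s < d \<and> dist ((q \<circ> r) n) s < d) sequentially"
    using tendstoD[OF lim_p \<open>0 < d\<close>] tendstoD[OF lim_q \<open>0 < d\<close>] by (rule eventually_conj)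
  then obtain n where "dist ((p \<circ> r) n) s < d \<and> dist ((q \<circ> r) n) s < d"
    by (auto simp: eventually_sequentially)
  then have "\<bar>f (p (r n)) - f (q (r n))\<bar> \<le> \<bar>jump f s\<bar> + 1 / real (Suc m)"
    by (intro d) (auto simp: dist_real_def)
  then have "e < \<bar>jump f s\<bar>"
    using gap[of "r n"] by linarith
  with \<open>0 < s\<close> \<open>c < s\<close> s show ?L
    by (intro bexI[of _ s]) (auto simp: large_jumps_def)
qed

section \<open>Sums over the points of a locally finite set\<close>

text \<open>
  The end point \<open>d\<close> is inserted so that the value is a time in \<open>(c, d]\<close> also when \<open>J\<close> has no point
  there.
\<close>

definition first_point :: "real set \<Rightarrow> real \<Rightarrow> real \<Rightarrow> real" where
  "first_point J c d = Min (insert d (J \<inter> {c<..d}))"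

lemma first_point_in:
  assumes "finite (J \<inter> {..d})" "c < d"
  shows "first_point J c d \<in> {c<..d}"
proof -
  have "finite (insert d (J \<inter> {c<..d}))"
    by (auto intro: finite_subset[OF _ assms(1)])
  from Min_in[OF this] show ?thesis
    using assms(2) by (auto simp: first_point_def)
qed

lemma first_point_le_iff:
  assumes "finite (J \<inter> {..d})"
  shows "first_point J c d \<le> y \<longleftrightarrow> d \<le> y \<or> (\<exists>s\<in>J. c < s \<and> s \<le> min d y)"
proof -
  have "finite (insert d (J \<inter> {c<..d}))"
    by (auto intro: finite_subset[OF _ assms])
  from Min_le_iff[OF this, of y] show ?thesis
    by (auto simp: first_point_def)
qed

lemma finite_set_separation:
  fixes A :: "real set"
  assumes "finite A"
  obtains \<delta> where "0 < \<delta>" "\<And>x y. x \<in> A \<Longrightarrow> y \<in> A \<Longrightarrow> x \<noteq> y \<Longrightarrow> \<delta> \<le> \<bar>x - y\<bar>"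
proof
  let ?D = "insert 1 ((\<lambda>(x, y). \<bar>x - y\<bar>) ` {z \<in> A \<times> A. fst z \<noteq> snd z})"
  have fin: "finite ?D"
    using assms by auto
  show "0 < Min ?D"
    using fin by (subst Min_gr_iff) auto
  fix x y assume "x \<in> A" "y \<in> A" "x \<noteq> y"
  then have "\<bar>x - y\<bar> \<in> ?D"
    by (intro insertI2 image_eqI[of _ _ "(x, y)"]) auto
  then show "Min ?D \<le> \<bar>x - y\<bar>"
    by (rule Min_le[OF fin])
qed

text \<open>
  Once the mesh of the partition is smaller than the distance between any two points of \<open>J\<close> up to
  \<open>t\<close>, each cell contains at most one of them, and this point is then the first one in the cell.
\<close>

lemma sum_first_points_tendsto:
  fixes g :: "real \<Rightarrow> real"
  assumes J: "J \<subseteq> {0<..}" "finite (J \<inter> {..t})" and "0 < t"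
    and g: "\<And>s. s \<notin> J \<Longrightarrow> g s = 0"
  shows "(\<lambda>n. \<Sum>i<Suc n. g (first_point J (t * real i / real (Suc n)) (t * real (Suc i) / real (Suc n))))
    \<longlonglongrightarrow> (\<Sum>s\<in>J \<inter> {..t}. g s)"
proof (rule tendsto_eventually)
  obtain \<delta> where "0 < \<delta>" and
    \<delta>: "\<And>x y. x \<in> J \<inter> {..t} \<Longrightarrow> y \<in> J \<inter> {..t} \<Longrightarrow> x \<noteq> y \<Longrightarrow> \<delta> \<le> \<bar>x - y\<bar>"
    using finite_set_separation[OF J(2)] by metis
  have "(\<lambda>n. t * (1 / real (Suc n))) \<longlonglongrightarrow> t * 0"
    by (rule tendsto_mult[OF tendsto_const LIMSEQ_Suc[OF lim_1_over_n]])
  then have "eventually (\<lambda>n. t * (1 / real (Suc n)) < \<delta>) sequentially"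
    using \<open>0 < \<delta>\<close> by (intro order_tendstoD) auto
  then show "eventually (\<lambda>n. (\<Sum>i<Suc n. g (first_point J (t * real i / real (Suc n))
      (t * real (Suc i) / real (Suc n)))) = (\<Sum>s\<in>J \<inter> {..t}. g s)) sequentially"
  proof eventually_elim
    case (elim n)
    define c where "c i = t * real i / real (Suc n)" for i
    have c_less: "c i < c (Suc i)" for i
      using \<open>0 < t\<close> by (simp add: c_def divide_strict_right_mono)
    have "c (Suc i) - c i = t * (1 / real (Suc n))" for i
      by (simp add: c_def diff_divide_distrib[symmetric] distrib_left)
    with elim have c_mesh: "c (Suc i) - c i < \<delta>" for i
      by simp
    have c_le: "c i \<le> t" if "i \<le> Suc n" for i
    proof -
      have "t * real i \<le> t * real (Suc n)"
        using that \<open>0 < t\<close> by (intro mult_left_mono) auto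
      then show ?thesis
        by (simp add: c_def pos_divide_le_eq del: of_nat_Suc)
    qed
    have cell: "g (first_point J (c i) (c (Suc i))) = (\<Sum>s\<in>J \<inter> {c i<..c (Suc i)}. g s)"
      if "i < Suc n" for i
    proof (cases "J \<inter> {c i<..c (Suc i)} = {}")
      case True
      then have "c (Suc i) \<notin> J"
        using c_less[of i] by auto
      with True show ?thesis
        by (simp add: first_point_def g)
    next
      case False
      then obtain x where x: "x \<in> J" "c i < x" "x \<le> c (Suc i)" by auto
      have "y = x" if "y \<in> J \<inter> {c i<..c (Suc i)}" for y
      proof (rule ccontr)
        assume "y \<noteq> x"
        have y: "y \<in> J" "c i < y" "y \<le> c (Suc i)"
          using that by simp_all
        have "c (Suc i) \<le> t"
          using c_le \<open>i < Suc n\<close> by simp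
        then have "\<delta> \<le> \<bar>y - x\<bar>"
          using x y \<open>y \<noteq> x\<close> by (intro \<delta>) simp_all
        then show False
          using c_mesh[of i] x y by linarith
      qed
      moreover have "x \<in> J \<inter> {c i<..c (Suc i)}"
        using x by simp
      ultimately have single: "J \<inter> {c i<..c (Suc i)} = {x}"
        by blast
      have "first_point J (c i) (c (Suc i)) = x"
        unfolding first_point_def single using x(3) by simp
      then show ?thesis
        unfolding single by simp
    qed
    have "(\<Sum>i<k. g (first_point J (c i) (c (Suc i)))) = (\<Sum>s\<in>J \<inter> {..c k}. g s)" if "k \<le> Suc n" for k
      using that
    proof (induction k)
      case 0
      have "J \<inter> {..c 0} = {}"
        using J(1) by (auto simp: c_def)
      then show ?case by simp
    next
      case (Suc k)
      have split: "J \<inter> {..c (Suc k)} = (J \<inter> {..c k}) \<union> (J \<inter> {c k<..c (Suc k)})"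
        using c_less[of k] by auto
      have "finite (J \<inter> {..c (Suc k)})"
        using c_le[OF Suc.prems] by (intro finite_subset[OF _ J(2)]) auto
      then have fin: "finite (J \<inter> {..c k})" "finite (J \<inter> {c k<..c (Suc k)})"
        unfolding split by simp_all
      have "(\<Sum>s\<in>J \<inter> {..c (Suc k)}. g s) =
          (\<Sum>s\<in>J \<inter> {..c k}. g s) + (\<Sum>s\<in>J \<inter> {c k<..c (Suc k)}. g s)"
        unfolding split by (rule sum.union_disjoint[OF fin]) auto
      then show ?case
        using Suc.IH Suc.prems cell[of k] by simp
    qed
    moreover have "c (Suc n) = t"
      by (simp add: c_def del: of_nat_Suc)
    ultimately have "(\<Sum>i<Suc n. g (first_point J (c i) (c (Suc i)))) = (\<Sum>s\<in>J \<inter> {..t}. g s)"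
      by (metis order_refl)
    then show ?case
      by (simp only: c_def)
  qed
qed

section \<open>Evaluating processes at random times\<close>

text \<open>
  The time is discretised from above, \<open>T\<close> being replaced by the next point of the grid of mesh
  \<open>1 / Suc n\<close>, which right-continuity permits; at a time with countably many values only the
  marginals of the process at deterministic times matter.
\<close>

lemma borel_measurable_at_random_time:
  fixes Z :: "'b \<Rightarrow> real \<Rightarrow> real"
  assumes T [measurable]: "T \<in> borel_measurable K"
    and pos: "\<And>x. x \<in> space K \<Longrightarrow> 0 \<le> T x"
    and marginals: "\<And>r. 0 \<le> r \<Longrightarrow> (\<lambda>x. Z x r) \<in> borel_measurable K"
    and right_cont: "\<And>x t. x \<in> space K \<Longrightarrow> 0 \<le> t \<Longrightarrow> continuous (at_right t) (Z x)"
  shows "(\<lambda>x. Z x (T x)) \<in> borel_measurable K"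
proof (rule borel_measurable_LIMSEQ_real)
  let ?T = "\<lambda>n (i::int). max 0 ((real_of_int i + 1) / real (Suc n))"
  show "(\<lambda>x. Z x (?T n \<lfloor>real (Suc n) * T x\<rfloor>)) \<in> borel_measurable K" for n
    by (rule measurable_compose_countable[of "\<lambda>i x. Z x (?T n i)"]) (auto intro: marginals)
  fix x assume x: "x \<in> space K"
  have bounds: "T x < ?T n \<lfloor>real (Suc n) * T x\<rfloor>" "?T n \<lfloor>real (Suc n) * T x\<rfloor> \<le> T x + 1 / real (Suc n)" for n
  proof -
    have "real (Suc n) * T x < real_of_int \<lfloor>real (Suc n) * T x\<rfloor> + 1"
      by linarith
    then have "T x < (real_of_int \<lfloor>real (Suc n) * T x\<rfloor> + 1) / real (Suc n)"
      by (simp add: pos_less_divide_eq mult.commute)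
    then show "T x < ?T n \<lfloor>real (Suc n) * T x\<rfloor>"
      by simp
    have "real_of_int \<lfloor>real (Suc n) * T x\<rfloor> + 1 \<le> real (Suc n) * T x + 1"
      by linarith
    then have "(real_of_int \<lfloor>real (Suc n) * T x\<rfloor> + 1) / real (Suc n) \<le> (real (Suc n) * T x + 1) / real (Suc n)"
      by (rule divide_right_mono) simp
    also have "\<dots> = T x + 1 / real (Suc n)"
      by (simp add: add_divide_distrib)
    finally show "?T n \<lfloor>real (Suc n) * T x\<rfloor> \<le> T x + 1 / real (Suc n)"
      using pos[OF x] by simp
  qed
  have "(\<lambda>n. T x + 1 / real (Suc n)) \<longlonglongrightarrow> T x + 0"
    by (rule tendsto_add[OF tendsto_const LIMSEQ_Suc[OF lim_1_over_n]])
  then have "(\<lambda>n. ?T n \<lfloor>real (Suc n) * T x\<rfloor>) \<longlonglongrightarrow> T x"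
    using tendsto_sandwich[OF always_eventually[OF allI[OF less_imp_le[OF bounds(1)]]]
        always_eventually[OF allI[OF bounds(2)]] tendsto_const] by (simp only: add_0_right)
  then have "filterlim (\<lambda>n. ?T n \<lfloor>real (Suc n) * T x\<rfloor>) (at_right (T x)) sequentially"
    by (rule tendsto_imp_filterlim_at_right) (rule always_eventually[OF allI[OF bounds(1)]])
  moreover have "(Z x \<longlongrightarrow> Z x (T x)) (at_right (T x))"
    using right_cont[OF x pos[OF x]] by (simp add: continuous_within)
  ultimately show "(\<lambda>n. Z x (?T n \<lfloor>real (Suc n) * T x\<rfloor>)) \<longlonglongrightarrow> Z x (T x)"
    using filterlim_compose by blast
qed

lemma space_generated_by_processes [simp]:
  "space (generated_by_processes M \<Y>) = space M \<times> {0..}"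
  unfolding generated_by_processes_def by (rule space_measure_of) auto

lemma measurable_generated_by_processes:
  assumes h: "h \<in> space K \<rightarrow> space M \<times> {0..}"
    and Y: "\<And>Y. Y \<in> \<Y> \<Longrightarrow> (\<lambda>x. Y (fst (h x)) (snd (h x))) \<in> borel_measurable K"
  shows "h \<in> K \<rightarrow>\<^sub>M generated_by_processes M \<Y>"
  unfolding generated_by_processes_def
proof (rule measurable_measure_of[OF _ h])
  fix A assume "A \<in> {(\<lambda>(\<omega>, t). Y \<omega> t) -` B \<inter> space M \<times> {0..} |Y B. Y \<in> \<Y> \<and> B \<in> sets borel}"
  then obtain Y B where A: "A = (\<lambda>(\<omega>, t). Y \<omega> t) -` B \<inter> space M \<times> {0..}" "Y \<in> \<Y>" "B \<in> sets borel"
    by blast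
  have "h -` A \<inter> space K = (\<lambda>x. Y (fst (h x)) (snd (h x))) -` B \<inter> space K"
    using h by (auto simp: A(1) case_prod_unfold Pi_iff)
  then show "h -` A \<inter> space K \<in> sets K"
    using measurable_sets[OF Y[OF A(2)] A(3)] by simp
qed auto

lemma generating_process_measurable:
  assumes "Y \<in> \<Y>"
  shows "(\<lambda>(\<omega>, t). Y \<omega> t) \<in> borel_measurable (generated_by_processes M \<Y>)"
proof (rule measurableI)
  fix B :: "real set" assume B: "B \<in> sets borel"
  show "(\<lambda>(\<omega>, t). Y \<omega> t) -` B \<inter> space (generated_by_processes M \<Y>)
    \<in> sets (generated_by_processes M \<Y>)"
    unfolding space_generated_by_processes
    unfolding generated_by_processes_def
    by (subst sets_measure_of) (use assms B in \<open>auto intro!: sigma_sets.Basic\<close>)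
qed simp

lemma space_optional_sigma [simp]: "space (optional_sigma M F) = space M \<times> {0..}"
  by (simp add: optional_sigma_def)

lemma cadlag_adapted_optional:
  assumes "adapted F Y" "\<And>\<omega>. \<omega> \<in> space M \<Longrightarrow> cadlag (Y \<omega>)"
  shows "(\<lambda>(\<omega>, t). Y \<omega> t) \<in> borel_measurable (optional_sigma M F)"
  unfolding optional_sigma_def by (rule generating_process_measurable) (use assms in auto)

lemma left_continuous_adapted_predictable:
  assumes "adapted F Y" "\<And>\<omega>. \<omega> \<in> space M \<Longrightarrow> left_continuous (Y \<omega>)"
  shows "(\<lambda>(\<omega>, t). Y \<omega> t) \<in> borel_measurable (predictable_sigma M F)"
  unfolding predictable_sigma_def by (rule generating_process_measurable) (use assms in auto)

context filtered_prob_space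
begin

lemma space_F: "0 \<le> t \<Longrightarrow> space (F t) = space M"
  using subalgebra_F by (simp add: subalgebra_def)

lemma measurable_F_mono:
  assumes "f \<in> borel_measurable (F s)" "0 \<le> s" "s \<le> t"
  shows "f \<in> borel_measurable (F t)"
  using assms sets_F_mono[OF assms(2,3)] space_F[of s] space_F[of t]
  by (auto simp: measurable_def)

lemma measurable_F_imp_M:
  assumes "f \<in> borel_measurable (F t)" "0 \<le> t"
  shows "f \<in> borel_measurable M"
  using measurable_from_subalg[OF subalgebra_F[OF assms(2)] assms(1)] .

lemma cadlag_stopped: "cadlag f \<Longrightarrow> 0 \<le> t \<Longrightarrow> cadlag (\<lambda>r. f (min t r))"
  by (rule cadlag_compose_mono[of f "min t"]) (auto simp: mono_def intro!: continuous_intros)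

text \<open>
  Up to time \<open>t\<close>, a cadlag adapted process coincides with the process stopped at \<open>t\<close>, all of whose
  marginals are known at time \<open>t\<close>.
\<close>

lemma optional_at_random_time:
  assumes "0 \<le> t" and T: "T \<in> borel_measurable (F t)"
    and bounds: "\<And>\<omega>. \<omega> \<in> space M \<Longrightarrow> T \<omega> \<in> {0..t}"
  shows "(\<lambda>\<omega>. (\<omega>, T \<omega>)) \<in> F t \<rightarrow>\<^sub>M optional_sigma M F"
  unfolding optional_sigma_def
proof (rule measurable_generated_by_processes)
  show "(\<lambda>\<omega>. (\<omega>, T \<omega>)) \<in> space (F t) \<rightarrow> space M \<times> {0..}"
    using bounds by (auto simp: space_F[OF assms(1)])
  fix Y assume Y: "Y \<in> {Y. adapted F Y \<and> (\<forall>\<omega>\<in>space M. cadlag (Y \<omega>))}"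
  have "(\<lambda>\<omega>. Y \<omega> (min t (T \<omega>))) \<in> borel_measurable (F t)"
  proof (rule borel_measurable_at_random_time[OF T, of "\<lambda>\<omega> r. Y \<omega> (min t r)"])
    fix r :: real assume "0 \<le> r"
    have "(\<lambda>\<omega>. Y \<omega> (min t r)) \<in> borel_measurable (F (min t r))"
      using Y \<open>0 \<le> r\<close> \<open>0 \<le> t\<close> by (simp add: adapted_def)
    then show "(\<lambda>\<omega>. Y \<omega> (min t r)) \<in> borel_measurable (F t)"
      by (rule measurable_F_mono) (use \<open>0 \<le> r\<close> \<open>0 \<le> t\<close> in auto)
  next
    fix \<omega> and r :: real assume "\<omega> \<in> space (F t)" "0 \<le> r"
    then show "continuous (at_right r) (\<lambda>r. Y \<omega> (min t r))"
      using Y cadlag_stopped[of "Y \<omega>" t] \<open>0 \<le> t\<close> by (auto simp: cadlag_def space_F)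
  qed (use bounds in \<open>auto simp: space_F[OF assms(1)]\<close>)
  then show "(\<lambda>\<omega>. Y (fst (\<omega>, T \<omega>)) (snd (\<omega>, T \<omega>))) \<in> borel_measurable (F t)"
    by (rule measurable_cong[THEN iffD1, rotated]) (use bounds in \<open>auto simp: space_F[OF assms(1)]\<close>)
qed

text \<open>Paths of optional processes are Borel functions of time.\<close>

lemma optional_section:
  assumes "\<omega> \<in> space M"
  shows "(\<lambda>s. (\<omega>, s)) \<in> restrict_space borel {0..} \<rightarrow>\<^sub>M optional_sigma M F"
  unfolding optional_sigma_def
proof (rule measurable_generated_by_processes)
  show "(\<lambda>s. (\<omega>, s)) \<in> space (restrict_space borel {0..}) \<rightarrow> space M \<times> {0..}"
    using assms by (auto simp: space_restrict_space)
  fix Y assume Y: "Y \<in> {Y. adapted F Y \<and> (\<forall>\<omega>\<in>space M. cadlag (Y \<omega>))}"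
  have "(\<lambda>s. Y \<omega> s) \<in> borel_measurable (restrict_space borel {0..})"
    by (rule borel_measurable_at_random_time[of "\<lambda>s. s" _ "\<lambda>_ s. Y \<omega> s"])
       (use Y assms in \<open>auto simp: cadlag_def space_restrict_space intro!: measurable_restrict_space1\<close>)
  then show "(\<lambda>s. Y (fst (\<omega>, s)) (snd (\<omega>, s))) \<in> borel_measurable (restrict_space borel {0..})"
    by simp
qed

lemma optional_at_fixed_time:
  assumes "Z \<in> borel_measurable (optional_sigma M F)" "0 \<le> t"
  shows "(\<lambda>\<omega>. Z (\<omega>, t)) \<in> borel_measurable (F t)"
  using measurable_compose[OF optional_at_random_time[OF assms(2), of "\<lambda>_. t"] assms(1)] assms(2)
  by simp

text \<open>
  Right-continuity of the filtration enters here: the right limit at \<open>t\<close> is known at every time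
  \<open>u > t\<close>, hence at time \<open>t\<close>.
\<close>

lemma adapted_right_limit:
  assumes F: "usual_conditions M F" and X: "adapted F X"
    and reg: "\<And>\<omega>. \<omega> \<in> space M \<Longrightarrow> regulated (X \<omega>)"
  shows "adapted F (\<lambda>\<omega>. right_limit (X \<omega>))"
  unfolding adapted_def
proof (intro allI impI measurableI)
  fix t :: real and B :: "real set"
  assume "0 \<le> t" and B: "B \<in> sets borel"
  have "(\<lambda>\<omega>. right_limit (X \<omega>) t) \<in> borel_measurable (F u)" if "t < u" for u
  proof (rule borel_measurable_LIMSEQ_real)
    show "(\<lambda>\<omega>. X \<omega> (min u (t + 1 / real (Suc n)))) \<in> borel_measurable (F u)" for n
      by (rule measurable_F_mono[of _ "min u (t + 1 / real (Suc n))"])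
         (use X \<open>0 \<le> t\<close> that in \<open>auto simp: adapted_def intro: add_nonneg_nonneg\<close>)
    fix \<omega> assume "\<omega> \<in> space (F u)"
    then have \<omega>: "\<omega> \<in> space M"
      using space_F[of u] \<open>0 \<le> t\<close> that by simp
    have "(\<lambda>n. min u (t + 1 / real (Suc n))) \<longlonglongrightarrow> min u (t + 0)"
      by (rule tendsto_min[OF tendsto_const tendsto_add[OF tendsto_const LIMSEQ_Suc[OF lim_1_over_n]]])
    then have "(\<lambda>n. min u (t + 1 / real (Suc n))) \<longlonglongrightarrow> t"
      using that by simp
    then have "filterlim (\<lambda>n. min u (t + 1 / real (Suc n))) (at_right t) sequentially"
      by (rule tendsto_imp_filterlim_at_right) (use that in auto)
    then show "(\<lambda>n. X \<omega> (min u (t + 1 / real (Suc n)))) \<longlonglongrightarrow> right_limit (X \<omega>) t"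
      using filterlim_compose[OF regulated_tendsto_right[OF reg[OF \<omega>] \<open>0 \<le> t\<close>]] by blast
  qed
  then have "(\<lambda>\<omega>. right_limit (X \<omega>) t) -` B \<inter> space (F u) \<in> sets (F u)" if "t < u" for u
    using measurable_sets[OF _ B] that by blast
  then have "(\<lambda>\<omega>. right_limit (X \<omega>) t) -` B \<inter> space M \<in> (\<Inter>u\<in>{t<..}. sets (F u))"
    using space_F \<open>0 \<le> t\<close> by auto
  then show "(\<lambda>\<omega>. right_limit (X \<omega>) t) -` B \<inter> space (F t) \<in> sets (F t)"
    using F \<open>0 \<le> t\<close> space_F[of t] by (simp add: usual_conditions_def)
qed simp

end

section \<open>Step processes carried by the large jumps\<close>

context filtered_prob_space
begin

lemma large_jump_event:
  assumes Y: "adapted F Y" "\<And>\<omega>. \<omega> \<in> space M \<Longrightarrow> cadlag (Y \<omega>)"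
    and "0 \<le> c" "0 \<le> u" "0 < e"
  shows "{\<omega> \<in> space M. \<exists>s\<in>large_jumps (Y \<omega>) e. c < s \<and> s \<le> u} \<in> sets (F u)"
proof -
  let ?S = "sampling_pairs c u"
  let ?gap = "\<lambda>m z. {\<omega> \<in> space (F u). e + 1 / real (Suc m) < \<bar>Y \<omega> (fst z) - Y \<omega> (snd z)\<bar>}"
  have gap: "?gap m z \<in> sets (F u)" if "z \<in> ?S m n" for m n z
  proof -
    have "0 \<le> c + 1 / real (Suc m)"
      using \<open>0 \<le> c\<close> by simp
    then have z: "0 \<le> fst z" "fst z \<le> u" "0 \<le> snd z" "snd z \<le> u"
      using that by (auto simp: sampling_pairs_def)
    have [measurable]: "(\<lambda>\<omega>. Y \<omega> (fst z)) \<in> borel_measurable (F u)"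
      by (rule measurable_F_mono[OF _ z(1,2)]) (use Y(1) z(1) in \<open>simp add: adapted_def\<close>)
    have [measurable]: "(\<lambda>\<omega>. Y \<omega> (snd z)) \<in> borel_measurable (F u)"
      by (rule measurable_F_mono[OF _ z(3,4)]) (use Y(1) z(3) in \<open>simp add: adapted_def\<close>)
    show ?thesis by measurable
  qed
  have "(\<Union>z\<in>?S m n. ?gap m z) \<in> sets (F u)" for m n
    by (rule sets.countable_UN'[OF countable_sampling_pairs]) (auto intro: gap simp del: of_nat_Suc)
  then have "(\<Inter>n. \<Union>z\<in>?S m n. ?gap m z) \<in> sets (F u)" for m
    by (intro sets.countable_INT image_subsetI) simp_all
  then have "(\<Union>m. \<Inter>n. \<Union>z\<in>?S m n. ?gap m z) \<in> sets (F u)"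
    by (intro sets.countable_UN image_subsetI) simp
  also have "(\<Union>m. \<Inter>n. \<Union>z\<in>?S m n. ?gap m z) =
      {\<omega> \<in> space M. \<exists>m. \<forall>n. \<exists>(p, q)\<in>?S m n. e + 1 / real (Suc m) < \<bar>Y \<omega> p - Y \<omega> q\<bar>}"
    by (simp add: set_eq_iff space_F[OF \<open>0 \<le> u\<close>] case_prod_unfold)
  also have "\<dots> = {\<omega> \<in> space M. \<exists>s\<in>large_jumps (Y \<omega>) e. c < s \<and> s \<le> u}"
    by (rule Collect_cong, rule conj_cong[OF refl])
       (rule large_jump_iff_sampling[OF Y(2) \<open>0 \<le> c\<close> \<open>0 < e\<close>, symmetric])
  finally show ?thesis .
qed

text \<open>
  The time of the first large jump after \<open>c\<close> has passed by time \<open>y\<close> iff there is a large jump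
  in \<open>(c, y]\<close>, an event known at time \<open>y\<close>.
\<close>

lemma measurable_first_large_jump:
  assumes Y: "adapted F Y" "\<And>\<omega>. \<omega> \<in> space M \<Longrightarrow> cadlag (Y \<omega>)"
    and "0 \<le> c" "c < d" "0 < e"
  shows "(\<lambda>\<omega>. first_point (large_jumps (Y \<omega>) e) c d) \<in> borel_measurable (F d)"
proof (rule borel_measurableI_le)
  fix y
  have "0 \<le> d" using assms by simp
  have iff: "first_point (large_jumps (Y \<omega>) e) c d \<le> y \<longleftrightarrow>
      d \<le> y \<or> (\<exists>s\<in>large_jumps (Y \<omega>) e. c < s \<and> s \<le> min d y)" if "\<omega> \<in> space M" for \<omega>
    by (rule first_point_le_iff)
       (rule finite_large_jumps[OF cadlag_imp_regulated[OF Y(2)[OF that]] \<open>0 < e\<close>])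
  consider "d \<le> y" | "y < c" | "c \<le> y" "y < d" by linarith
  then show "{\<omega> \<in> space (F d). first_point (large_jumps (Y \<omega>) e) c d \<le> y} \<in> sets (F d)"
  proof cases
    case 1
    then have "{\<omega> \<in> space (F d). first_point (large_jumps (Y \<omega>) e) c d \<le> y} = space (F d)"
      using iff by (auto simp: space_F[OF \<open>0 \<le> d\<close>])
    then show ?thesis by (simp only: sets.top)
  next
    case 2
    then have "{\<omega> \<in> space (F d). first_point (large_jumps (Y \<omega>) e) c d \<le> y} = {}"
      using iff \<open>c < d\<close> by (auto simp: space_F[OF \<open>0 \<le> d\<close>])
    then show ?thesis by (simp only: sets.empty_sets)
  next
    case 3
    then have "0 \<le> y" using \<open>0 \<le> c\<close> by simp
    have "{\<omega> \<in> space (F d). first_point (large_jumps (Y \<omega>) e) c d \<le> y} =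
        {\<omega> \<in> space M. \<exists>s\<in>large_jumps (Y \<omega>) e. c < s \<and> s \<le> y}"
      using iff 3 by (auto simp: space_F[OF \<open>0 \<le> d\<close>] min_def)
    also have "\<dots> \<in> sets (F y)"
      by (rule large_jump_event[OF Y \<open>0 \<le> c\<close> \<open>0 \<le> y\<close> \<open>0 < e\<close>])
    also have "sets (F y) \<subseteq> sets (F d)"
      using sets_F_mono \<open>0 \<le> y\<close> 3 by simp
    finally show ?thesis .
  qed
qed

text \<open>
  The sum is the limit of sums over finer and finer partitions in which every cell contributes
  the value at its first large jump only; this value is an optional process evaluated at a random
  time.
\<close>

lemma adapted_sum_large_jumps:
  fixes g :: "'a \<times> real \<Rightarrow> real"
  assumes Y: "adapted F Y" "\<And>\<omega>. \<omega> \<in> space M \<Longrightarrow> cadlag (Y \<omega>)" and "0 < e"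
    and g: "g \<in> borel_measurable (optional_sigma M F)"
    and g_zero: "\<And>\<omega> s. \<omega> \<in> space M \<Longrightarrow> s \<notin> large_jumps (Y \<omega>) e \<Longrightarrow> g (\<omega>, s) = 0"
  shows "adapted F (\<lambda>\<omega> t. \<Sum>s\<in>large_jumps (Y \<omega>) e \<inter> {..t}. g (\<omega>, s))"
  unfolding adapted_def
proof (intro allI impI)
  fix t :: real assume "0 \<le> t"
  let ?J = "\<lambda>\<omega>. large_jumps (Y \<omega>) e"
  note fin = finite_large_jumps[OF cadlag_imp_regulated[OF Y(2)] \<open>0 < e\<close>]
  show "(\<lambda>\<omega>. \<Sum>s\<in>?J \<omega> \<inter> {..t}. g (\<omega>, s)) \<in> borel_measurable (F t)"
  proof (cases "t = 0")
    case True
    have "?J \<omega> \<inter> {..t} = {}" for \<omega>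
      using True by (auto simp: large_jumps_def)
    then show ?thesis by simp
  next
    case False
    with \<open>0 \<le> t\<close> have "0 < t" by simp
    show ?thesis
    proof (rule borel_measurable_LIMSEQ_real)
      fix \<omega> assume "\<omega> \<in> space (F t)"
      then have \<omega>: "\<omega> \<in> space M" by (simp add: space_F[OF \<open>0 \<le> t\<close>])
      show "(\<lambda>n. \<Sum>i<Suc n. g (\<omega>, first_point (?J \<omega>) (t * real i / real (Suc n)) (t * real (Suc i) / real (Suc n))))
          \<longlonglongrightarrow> (\<Sum>s\<in>?J \<omega> \<inter> {..t}. g (\<omega>, s))"
        by (rule sum_first_points_tendsto[OF _ fin[OF \<omega>] \<open>0 < t\<close> g_zero[OF \<omega>]])
           (auto simp: large_jumps_def)
    next
      fix n
      show "(\<lambda>\<omega>. \<Sum>i<Suc n. g (\<omega>, first_point (?J \<omega>) (t * real i / real (Suc n)) (t * real (Suc i) / real (Suc n))))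
          \<in> borel_measurable (F t)"
      proof (rule borel_measurable_sum)
        fix i assume i: "i \<in> {..<Suc n}"
        define c d where "c = t * real i / real (Suc n)" and "d = t * real (Suc i) / real (Suc n)"
        have "0 \<le> c"
          using \<open>0 < t\<close> by (simp add: c_def)
        have "c < d"
          using \<open>0 < t\<close> by (simp add: c_def d_def divide_strict_right_mono)
        have "t * real (Suc i) \<le> t * real (Suc n)"
          using i \<open>0 < t\<close> by (intro mult_left_mono) auto
        then have "d \<le> t"
          by (simp add: d_def pos_divide_le_eq del: of_nat_Suc)
        have "(\<lambda>\<omega>. first_point (?J \<omega>) c d) \<in> borel_measurable (F t)"
          by (rule measurable_F_mono[OF measurable_first_large_jump[OF Y \<open>0 \<le> c\<close> \<open>c < d\<close> \<open>0 < e\<close>]])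
             (use \<open>0 \<le> c\<close> \<open>c < d\<close> \<open>d \<le> t\<close> in auto)
        moreover have "first_point (?J \<omega>) c d \<in> {0..t}" if "\<omega> \<in> space M" for \<omega>
          using first_point_in[OF fin[OF that] \<open>c < d\<close>] \<open>0 \<le> c\<close> \<open>d \<le> t\<close> by auto
        ultimately have "(\<lambda>\<omega>. (\<omega>, first_point (?J \<omega>) c d)) \<in> F t \<rightarrow>\<^sub>M optional_sigma M F"
          by (rule optional_at_random_time[OF \<open>0 \<le> t\<close>])
        from measurable_compose[OF this g]
        show "(\<lambda>\<omega>. g (\<omega>, first_point (?J \<omega>) (t * real i / real (Suc n)) (t * real (Suc i) / real (Suc n))))
            \<in> borel_measurable (F t)"
          by (simp only: c_def d_def)
      qed
    qed
  qed
qed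

lemma cadlag_shifted: "cadlag f \<Longrightarrow> 0 \<le> d \<Longrightarrow> cadlag (\<lambda>t. f (max 0 (t - d)))"
  by (rule cadlag_compose_mono[of f "\<lambda>t. max 0 (t - d)"]) (auto simp: mono_def intro!: continuous_intros)

text \<open>The left limits are limits of cadlag processes, namely of \<open>Y\<close> delayed by \<open>1 / Suc n\<close>.\<close>

lemma optional_jump:
  assumes Y: "adapted F Y" "\<And>\<omega>. \<omega> \<in> space M \<Longrightarrow> cadlag (Y \<omega>)"
  shows "(\<lambda>(\<omega>, t). jump (Y \<omega>) t) \<in> borel_measurable (optional_sigma M F)"
proof -
  have "(\<lambda>(\<omega>, t). Y \<omega> (max 0 (t - 1 / real (Suc n)))) \<in> borel_measurable (optional_sigma M F)" for n
  proof (rule cadlag_adapted_optional)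
    show "adapted F (\<lambda>\<omega> t. Y \<omega> (max 0 (t - 1 / real (Suc n))))"
      unfolding adapted_def
    proof (intro allI impI)
      fix t :: real assume "0 \<le> t"
      show "(\<lambda>\<omega>. Y \<omega> (max 0 (t - 1 / real (Suc n)))) \<in> borel_measurable (F t)"
        by (rule measurable_F_mono[of _ "max 0 (t - 1 / real (Suc n))"])
           (use Y(1) \<open>0 \<le> t\<close> in \<open>auto simp: adapted_def\<close>)
    qed
    show "cadlag (\<lambda>t. Y \<omega> (max 0 (t - 1 / real (Suc n))))" if "\<omega> \<in> space M" for \<omega>
      by (rule cadlag_shifted[OF Y(2)[OF that]]) simp
  qed
  then have delayed: "(\<lambda>z. Y (fst z) (max 0 (snd z - 1 / real (Suc n)))) \<in> borel_measurable (optional_sigma M F)" for n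
    by (simp only: case_prod_unfold)
  have left: "(\<lambda>z. left_limit (Y (fst z)) (snd z)) \<in> borel_measurable (optional_sigma M F)"
  proof (rule borel_measurable_LIMSEQ_real)
    fix z assume "z \<in> space (optional_sigma M F)"
    then show "(\<lambda>n. Y (fst z) (max 0 (snd z - 1 / real (Suc n)))) \<longlonglongrightarrow> left_limit (Y (fst z)) (snd z)"
      by (intro left_limit_sequentially Y(2)) auto
  qed (rule delayed)
  have "(\<lambda>z. Y (fst z) (snd z)) \<in> borel_measurable (optional_sigma M F)"
    using cadlag_adapted_optional[OF Y] by (simp only: case_prod_unfold)
  from borel_measurable_diff[OF this left]
  show ?thesis
    by (rule measurable_cong[THEN iffD1, rotated])
       (auto simp: jump_def cadlag_right_limit[OF Y(2)])
qed

lemma optional_sum_large_jumps: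
  fixes g :: "'a \<times> real \<Rightarrow> real"
  assumes Y: "adapted F Y" "\<And>\<omega>. \<omega> \<in> space M \<Longrightarrow> cadlag (Y \<omega>)" and "0 < e"
    and g: "g \<in> borel_measurable (optional_sigma M F)"
    and g_zero: "\<And>\<omega> s. \<omega> \<in> space M \<Longrightarrow> s \<notin> large_jumps (Y \<omega>) e \<Longrightarrow> g (\<omega>, s) = 0"
  shows "(\<lambda>(\<omega>, t). \<Sum>s\<in>large_jumps (Y \<omega>) e \<inter> {..t}. g (\<omega>, s)) \<in> borel_measurable (optional_sigma M F)"
  by (rule cadlag_adapted_optional[OF adapted_sum_large_jumps[OF assms]])
     (auto intro!: cadlag_sum_large_jumps cadlag_imp_regulated Y(2) \<open>0 < e\<close>)

lemma optional_large_jumps_indicator: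
  assumes Y: "adapted F Y" "\<And>\<omega>. \<omega> \<in> space M \<Longrightarrow> cadlag (Y \<omega>)" and "0 < e"
  shows "(\<lambda>z. indicator (large_jumps (Y (fst z)) e) (snd z) :: real) \<in> borel_measurable (optional_sigma M F)"
proof -
  have [measurable]: "(\<lambda>z. jump (Y (fst z)) (snd z)) \<in> borel_measurable (optional_sigma M F)"
    using optional_jump[OF Y] by (simp only: case_prod_unfold)
  have "(\<lambda>z. indicator {x. e < \<bar>x\<bar>} (jump (Y (fst z)) (snd z)) :: real) \<in> borel_measurable (optional_sigma M F)"
    by measurable
  then show ?thesis
  proof (rule measurable_cong[THEN iffD1, rotated])
    fix z assume "z \<in> space (optional_sigma M F)"
    then have "0 \<le> snd z" by auto
    \<comment> \<open>Large jump times are positive by definition; time \<open>0\<close> carries no jump.\<close>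
    moreover have "snd z \<noteq> 0" if "e < \<bar>jump (Y (fst z)) (snd z)\<bar>"
      using that \<open>0 < e\<close> jump_at_0[of "Y (fst z)"] by auto
    ultimately show "indicator {x. e < \<bar>x\<bar>} (jump (Y (fst z)) (snd z)) =
        (indicator (large_jumps (Y (fst z)) e) (snd z) :: real)"
      by (auto simp: large_jumps_def indicator_def less_le)
  qed
qed

text \<open>
  The number of large jumps strictly before \<open>t\<close> is the number up to \<open>t\<close>, minus one if there is a
  large jump at \<open>t\<close>.
\<close>

lemma
  assumes Y: "adapted F Y" "\<And>\<omega>. \<omega> \<in> space M \<Longrightarrow> cadlag (Y \<omega>)" and "0 < e"
  shows adapted_card_large_jumps_before:
      "adapted F (\<lambda>\<omega> t. real (card (large_jumps (Y \<omega>) e \<inter> {..<t})))"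
    and optional_card_large_jumps_before:
      "(\<lambda>z. real (card (large_jumps (Y (fst z)) e \<inter> {..<snd z}))) \<in> borel_measurable (optional_sigma M F)"
proof -
  let ?J = "\<lambda>\<omega>. large_jumps (Y \<omega>) e" and ?I = "\<lambda>z. indicator (large_jumps (Y (fst z)) e) (snd z) :: real"
  note fin = finite_large_jumps[OF cadlag_imp_regulated[OF Y(2)] \<open>0 < e\<close>]
  have before: "(\<Sum>s\<in>?J \<omega> \<inter> {..t}. ?I (\<omega>, s)) - ?I (\<omega>, t) = real (card (?J \<omega> \<inter> {..<t}))"
    if "\<omega> \<in> space M" for \<omega> t
  proof -
    have "(\<Sum>s\<in>?J \<omega> \<inter> {..t}. ?I (\<omega>, s)) = real (card (?J \<omega> \<inter> {..t}))"
      by simp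
    moreover have "card (?J \<omega> \<inter> {..t}) = card (?J \<omega> \<inter> {..<t}) + (if t \<in> ?J \<omega> then 1 else 0)"
    proof (cases "t \<in> ?J \<omega>")
      case True
      then have split: "?J \<omega> \<inter> {..t} = insert t (?J \<omega> \<inter> {..<t})" by auto
      have "finite (?J \<omega> \<inter> {..<t})"
        using fin[OF that, of t] unfolding split by simp
      then have "card (insert t (?J \<omega> \<inter> {..<t})) = Suc (card (?J \<omega> \<inter> {..<t}))"
        by (rule card_insert_disjoint) simp
      with True show ?thesis
        unfolding split by simp
    next
      case False
      then have "?J \<omega> \<inter> {..t} = ?J \<omega> \<inter> {..<t}" by (auto simp: less_le)
      then show ?thesis using False by simp
    qed
    ultimately show ?thesis
      by (simp add: indicator_def)
  qed
  have zero: "?I (\<omega>, s) = 0" if "s \<notin> ?J \<omega>" for \<omega> s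
    using that by simp
  note I = optional_large_jumps_indicator[OF Y \<open>0 < e\<close>]
  note adapted_sum = adapted_sum_large_jumps[OF Y \<open>0 < e\<close> I zero]
  note optional_sum = optional_sum_large_jumps[OF Y \<open>0 < e\<close> I zero, unfolded case_prod_unfold]
  show "(\<lambda>z. real (card (?J (fst z) \<inter> {..<snd z}))) \<in> borel_measurable (optional_sigma M F)"
    by (rule measurable_cong[THEN iffD1, OF _ borel_measurable_diff[OF optional_sum I]])
       (use before in \<open>auto simp only: space_optional_sigma mem_Times_iff fst_conv snd_conv prod.collapse\<close>)
  show "adapted F (\<lambda>\<omega> t. real (card (?J \<omega> \<inter> {..<t})))"
    unfolding adapted_def
  proof (intro allI impI)
    fix t :: real assume "0 \<le> t"
    have "(\<lambda>\<omega>. (\<Sum>s\<in>?J \<omega> \<inter> {..t}. ?I (\<omega>, s)) - ?I (\<omega>, t)) \<in> borel_measurable (F t)"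
      using adapted_sum \<open>0 \<le> t\<close> optional_at_fixed_time[OF I \<open>0 \<le> t\<close>]
      unfolding adapted_def by (intro borel_measurable_diff) auto
    then show "(\<lambda>\<omega>. real (card (?J \<omega> \<inter> {..<t}))) \<in> borel_measurable (F t)"
      by (rule measurable_cong[THEN iffD1, rotated]) (use before space_F[OF \<open>0 \<le> t\<close>] in blast)
  qed
qed

end

section \<open>The jump measure as an image of counting measure\<close>

lemma unordered_sum_indicator:
  "unordered_sum (indicator S) L = emeasure (count_space UNIV) (S \<inter> L)"
proof -
  have sum: "(\<Sum>s\<in>A. indicator S s :: ennreal) = of_nat (card (A \<inter> S))" if "finite A" for A
    using that by (simp add: indicator_def)
  show ?thesis
  proof (cases "finite (S \<inter> L)")
    case True
    have "unordered_sum (indicator S) L = of_nat (card (S \<inter> L))"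
      unfolding unordered_sum_def
    proof (rule antisym)
      show "(SUP A\<in>{A. finite A \<and> A \<subseteq> L}. \<Sum>s\<in>A. indicator S s) \<le> (of_nat (card (S \<inter> L)) :: ennreal)"
        using True by (intro SUP_least) (auto simp: sum intro!: card_mono)
      have "of_nat (card (S \<inter> L)) = (\<Sum>s\<in>S \<inter> L. indicator S s :: ennreal)"
        using sum[OF True] by (simp add: Int_commute Int_left_commute)
      also have "\<dots> \<le> (SUP A\<in>{A. finite A \<and> A \<subseteq> L}. \<Sum>s\<in>A. indicator S s)"
        using True by (intro SUP_upper) auto
      finally show "of_nat (card (S \<inter> L)) \<le> (SUP A\<in>{A. finite A \<and> A \<subseteq> L}. \<Sum>s\<in>A. indicator S s :: ennreal)" .
    qed
    with True show ?thesis
      by (simp add: emeasure_count_space)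
  next
    case False
    have "(of_nat n :: ennreal) \<le> unordered_sum (indicator S) L" for n
    proof -
      obtain A where A: "finite A" "card A = n" "A \<subseteq> S \<inter> L"
        using infinite_arbitrarily_large[OF False] by blast
      then have "of_nat n = (\<Sum>s\<in>A. indicator S s :: ennreal)"
        using sum[OF A(1)] by (metis Int_absorb2 le_inf_iff)
      also have "\<dots> \<le> unordered_sum (indicator S) L"
        unfolding unordered_sum_def using A by (intro SUP_upper) auto
      finally show ?thesis .
    qed
    then have "(SUP n. of_nat n) \<le> unordered_sum (indicator S) L"
      by (rule SUP_least)
    then have "unordered_sum (indicator S) L = \<infinity>"
      by (simp add: ennreal_SUP_of_nat_eq_top top_unique)
    with False show ?thesis
      by (simp add: emeasure_count_space)
  qed
qed

definition jump_times :: "(real \<Rightarrow> real) \<Rightarrow> real set" where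
  "jump_times f = {s. 0 < s \<and> jump f s \<noteq> 0}"

definition jump_distr :: "(real \<Rightarrow> real) \<Rightarrow> (real \<times> real) measure" where
  "jump_distr f = distr (count_space (jump_times f)) mark_space (\<lambda>s. (s, jump f s))"

lemma space_mark_space: "space mark_space = {0..} \<times> UNIV"
  by (simp add: space_pair_measure space_restrict_space)

lemma measurable_jump_mark:
  "(\<lambda>s. (s, jump f s)) \<in> count_space (jump_times f) \<rightarrow>\<^sub>M mark_space"
  by (auto simp: measurable_count_space_eq1 space_mark_space jump_times_def)

lemma space_jump_distr [simp]: "space (jump_distr f) = space mark_space"
  and sets_jump_distr [simp]: "sets (jump_distr f) = sets mark_space"
  by (simp_all add: jump_distr_def)

lemma emeasure_jump_distr:
  assumes "G \<in> sets mark_space"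
  shows "emeasure (jump_distr f) G = emeasure (count_space UNIV) {s \<in> jump_times f. (s, jump f s) \<in> G}"
proof -
  have "emeasure (jump_distr f) G =
      emeasure (count_space (jump_times f)) ((\<lambda>s. (s, jump f s)) -` G \<inter> jump_times f)"
    unfolding jump_distr_def by (subst emeasure_distr[OF measurable_jump_mark assms]) simp
  also have "(\<lambda>s. (s, jump f s)) -` G \<inter> jump_times f = {s \<in> jump_times f. (s, jump f s) \<in> G}"
    by auto
  finally show ?thesis
    by (simp add: emeasure_count_space)
qed

lemma jump_measure_eq_emeasure:
  assumes "\<omega> \<in> space M" "G \<in> sets mark_space"
  shows "jump_measure M X \<omega> G = emeasure (jump_distr (X \<omega>)) G"
proof -
  have "(\<lambda>s. indicator G (s, jump (X \<omega>) s) * indicator (jump_set M X) (\<omega>, s) :: ennreal) =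
      indicator {s. 0 \<le> s \<and> jump (X \<omega>) s \<noteq> 0 \<and> (s, jump (X \<omega>) s) \<in> G}"
    using assms(1) by (auto simp: fun_eq_iff jump_set_def indicator_def)
  then have "jump_measure M X \<omega> G = emeasure (count_space UNIV)
      ({s. 0 \<le> s \<and> jump (X \<omega>) s \<noteq> 0 \<and> (s, jump (X \<omega>) s) \<in> G} \<inter> {0<..})"
    unfolding jump_measure_def by (simp only: unordered_sum_indicator)
  also have "{s. 0 \<le> s \<and> jump (X \<omega>) s \<noteq> 0 \<and> (s, jump (X \<omega>) s) \<in> G} \<inter> {0<..} =
      {s \<in> jump_times (X \<omega>). (s, jump (X \<omega>) s) \<in> G}"
    by (auto simp: jump_times_def)
  finally show ?thesis
    by (simp only: emeasure_jump_distr[OF assms(2)])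
qed

lemma path_measure_jump_measure:
  assumes "\<omega> \<in> space M"
  shows "path_measure (jump_measure M X) \<omega> = jump_distr (X \<omega>)"
proof -
  have "path_measure (jump_measure M X) \<omega> =
      measure_of (space mark_space) (sets mark_space) (emeasure (jump_distr (X \<omega>)))"
    unfolding path_measure_def
    by (rule measure_of_eq[OF sets.space_closed])
       (simp add: sets.sigma_sets_eq jump_measure_eq_emeasure[OF assms])
  also have "\<dots> = jump_distr (X \<omega>)"
    using measure_of_of_measure[of "jump_distr (X \<omega>)"] by simp
  finally show ?thesis .
qed

lemma measure_space_jump_measure:
  assumes "\<omega> \<in> space M"
  shows "measure_space (space mark_space) (sets mark_space) (jump_measure M X \<omega>)"
proof -
  have "measure_space (space mark_space) (sets mark_space) (emeasure (jump_distr (X \<omega>)))"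
    using measure_space[of "jump_distr (X \<omega>)"] by simp
  then show ?thesis
    using measure_space_eq[OF sets.space_closed, of mark_space "emeasure (jump_distr (X \<omega>))" "jump_measure M X \<omega>"]
    by (simp add: sets.sigma_sets_eq jump_measure_eq_emeasure[OF assms])
qed

lemma nn_integral_jump_distr:
  assumes "h \<in> borel_measurable mark_space"
  shows "(\<integral>\<^sup>+z. h z \<partial>jump_distr f) = (\<integral>\<^sup>+s. h (s, jump f s) \<partial>count_space (jump_times f))"
  unfolding jump_distr_def by (rule nn_integral_distr[OF measurable_jump_mark]) (simp add: assms)

lemma emeasure_jump_distr_in_nat:
  assumes "G \<in> sets mark_space"
  shows "emeasure (jump_distr f) G \<in> range of_nat \<union> {\<infinity>}"
  by (simp add: emeasure_jump_distr[OF assms] emeasure_count_space)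

lemma emeasure_jump_distr_fibre:
  assumes "0 \<le> t"
  shows "emeasure (jump_distr f) ({t} \<times> UNIV) \<le> 1"
proof -
  have "{t} \<times> UNIV \<in> sets mark_space"
    using assms by (intro pair_measureI) (auto simp: sets_restrict_space_iff)
  then have "emeasure (jump_distr f) ({t} \<times> UNIV) =
      emeasure (count_space UNIV) {s \<in> jump_times f. (s, jump f s) \<in> {t} \<times> UNIV}"
    by (rule emeasure_jump_distr)
  also have "\<dots> \<le> emeasure (count_space UNIV) {t}"
    by (rule emeasure_mono) auto
  finally show ?thesis
    by (simp add: emeasure_count_space)
qed

lemma emeasure_jump_distr_zero: "emeasure (jump_distr f) ({0} \<times> UNIV) = 0"
proof -
  have "{0} \<times> UNIV \<in> sets mark_space"
    by (intro pair_measureI) (auto simp: sets_restrict_space_iff)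
  moreover have "{s \<in> jump_times f. (s, jump f s) \<in> {0} \<times> UNIV} = {}"
    by (auto simp: jump_times_def)
  ultimately show ?thesis
    by (simp only: emeasure_jump_distr emeasure_empty)
qed

section \<open>Optionality\<close>

lemma jump_times_eq_Union: "jump_times f = (\<Union>k. large_jumps f (1 / real (Suc k)))"
proof safe
  fix s assume "s \<in> jump_times f"
  then have s: "0 < s" "0 < \<bar>jump f s\<bar>"
    by (auto simp: jump_times_def)
  from reals_Archimedean[OF this(2)] obtain k where "1 / real (Suc k) < \<bar>jump f s\<bar>"
    by (auto simp: inverse_eq_divide)
  with s show "s \<in> (\<Union>k. large_jumps f (1 / real (Suc k)))"
    by (auto simp: large_jumps_def)
next
  fix s k assume "s \<in> large_jumps f (1 / real (Suc k))"
  then have "0 < s" "1 / real (Suc k) < \<bar>jump f s\<bar>"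
    by (auto simp: large_jumps_def)
  moreover have "0 < 1 / real (Suc k)"
    by simp
  ultimately show "s \<in> jump_times f"
    unfolding jump_times_def by auto
qed

lemma incseq_large_jumps: "incseq (\<lambda>k. large_jumps f (1 / real (Suc k)))"
proof (rule monoI)
  fix k l :: nat assume "k \<le> l"
  then have "1 / real (Suc l) \<le> 1 / real (Suc k)"
    by (intro divide_left_mono) auto
  then show "large_jumps f (1 / real (Suc k)) \<subseteq> large_jumps f (1 / real (Suc l))"
    unfolding large_jumps_def by auto
qed

text \<open>
  Restricting to jumps larger than \<open>1 / Suc k\<close> and truncating the integrand at \<open>k\<close> makes every term
  a finite sum of real numbers.
\<close>

lemma nn_integral_jump_times_eq_SUP:
  fixes w :: "real \<Rightarrow> ennreal"
  assumes "regulated f"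
  shows "(\<integral>\<^sup>+s. w s * indicator {..t} s \<partial>count_space (jump_times f)) =
    (SUP k. ennreal (\<Sum>s\<in>large_jumps f (1 / real (Suc k)) \<inter> {..t}.
      enn2real (min (of_nat k) (w s)) * indicator (large_jumps f (1 / real (Suc k))) s))"
proof -
  let ?J = "\<lambda>k. large_jumps f (1 / real (Suc k))"
  define h where "h k s = min (of_nat k) (w s) * indicator (?J k) s * (indicator {..t} s :: ennreal)" for k s
  have inc: "incseq h"
  proof (intro monoI le_funI)
    fix k l :: nat and s assume "k \<le> l"
    have "min (of_nat k) (w s) \<le> min (of_nat l) (w s)"
      using \<open>k \<le> l\<close> by (intro min.mono) simp_all
    moreover have "(indicator (?J k) s :: ennreal) \<le> indicator (?J l) s"
      using monoD[OF incseq_large_jumps \<open>k \<le> l\<close>] by (auto split: split_indicator)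
    ultimately show "h k s \<le> h l s"
      unfolding h_def by (intro mult_mono) auto
  qed
  have SUP_h: "(SUP k. h k s) = w s * indicator {..t} s" if "s \<in> jump_times f" for s
  proof -
    obtain K where "s \<in> ?J K"
      using \<open>s \<in> jump_times f\<close> unfolding jump_times_eq_Union by blast
    then have "s \<in> ?J k" if "K \<le> k" for k
      using monoD[OF incseq_large_jumps that] by blast
    then have ev: "eventually (\<lambda>k. min (of_nat k) (w s) * indicator {..t} s = h k s) sequentially"
      unfolding eventually_sequentially by (intro exI[of _ K]) (simp add: h_def)
    have "(\<lambda>k. min (of_nat k) (w s)) \<longlonglongrightarrow> min top (w s)"
      by (rule tendsto_min[OF of_nat_tendsto_top_ennreal tendsto_const])
    then have "(\<lambda>k. min (of_nat k) (w s) * (indicator {..t} s :: ennreal)) \<longlonglongrightarrow> w s * indicator {..t} s"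
      by (cases "s \<le> t") simp_all
    then have "(\<lambda>k. h k s) \<longlonglongrightarrow> w s * indicator {..t} s"
      using Lim_transform_eventually[OF _ ev] by simp
    moreover have "incseq (\<lambda>k. h k s)"
      using inc by (auto simp: mono_def le_fun_def)
    ultimately show ?thesis
      using LIMSEQ_SUP LIMSEQ_unique by blast
  qed
  have "(\<integral>\<^sup>+s. w s * indicator {..t} s \<partial>count_space (jump_times f)) =
      (\<integral>\<^sup>+s. (SUP k. h k s) \<partial>count_space (jump_times f))"
    by (rule nn_integral_cong) (simp add: SUP_h)
  also have "\<dots> = (SUP k. \<integral>\<^sup>+s. h k s \<partial>count_space (jump_times f))"
    by (rule nn_integral_monotone_convergence_SUP[OF inc]) simp
  also have "\<dots> = (SUP k. ennreal (\<Sum>s\<in>?J k \<inter> {..t}. enn2real (min (of_nat k) (w s)) * indicator (?J k) s))"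
  proof (rule SUP_cong[OF refl])
    fix k
    have "(\<integral>\<^sup>+s. h k s \<partial>count_space (jump_times f)) = (\<Sum>s\<in>?J k \<inter> {..t}. h k s)"
      using assms by (intro nn_integral_count_space' finite_large_jumps)
        (auto simp: h_def jump_times_eq_Union indicator_def)
    also have "\<dots> = (\<Sum>s\<in>?J k \<inter> {..t}. ennreal (enn2real (min (of_nat k) (w s)) * indicator (?J k) s))"
    proof (rule sum.cong[OF refl])
      fix s assume s: "s \<in> ?J k \<inter> {..t}"
      have "min (of_nat k) (w s) < top"
        by (simp add: min_less_iff_disj of_nat_less_top)
      with s show "h k s = ennreal (enn2real (min (of_nat k) (w s)) * indicator (?J k) s)"
        by (simp add: h_def)
    qed
    also have "\<dots> = ennreal (\<Sum>s\<in>?J k \<inter> {..t}. enn2real (min (of_nat k) (w s)) * indicator (?J k) s)"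
      by (rule sum_ennreal) simp
    finally show "(\<integral>\<^sup>+s. h k s \<partial>count_space (jump_times f)) =
      ennreal (\<Sum>s\<in>?J k \<inter> {..t}. enn2real (min (of_nat k) (w s)) * indicator (?J k) s)" .
  qed
  finally show ?thesis .
qed

lemma strip_in_mark_space: "{0..t} \<times> UNIV \<in> sets mark_space"
  by (intro pair_measureI) (auto simp: sets_restrict_space_iff)

context filtered_prob_space
begin

lemma measurable_optional_section_mark:
  assumes "\<omega> \<in> space M"
  shows "(\<lambda>z. ((\<omega>, fst z), snd z)) \<in> mark_space \<rightarrow>\<^sub>M optional_sigma M F \<Otimes>\<^sub>M borel"
  by (intro measurable_Pair measurable_compose[OF measurable_fst optional_section[OF assms]] measurable_snd)

lemma optional_random_measure_jump_measure:
  assumes Y: "adapted F Y" "\<And>\<omega>. \<omega> \<in> space M \<Longrightarrow> cadlag (Y \<omega>)"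
  shows "optional_random_measure M F (jump_measure M Y)"
  unfolding optional_random_measure_def
proof (intro allI impI)
  fix W :: "('a \<times> real) \<times> real \<Rightarrow> ennreal"
  assume W: "W \<in> borel_measurable (optional_sigma M F \<Otimes>\<^sub>M borel)"
  let ?O = "optional_sigma M F"
  let ?J = "\<lambda>k \<omega>. large_jumps (Y \<omega>) (1 / real (Suc k))"
  define w where "w z = W (z, jump (Y (fst z)) (snd z))" for z
  define g where "g k z = enn2real (min (of_nat k) (w z)) * indicator (?J k (fst z)) (snd z)" for k z
  have jump: "(\<lambda>z. jump (Y (fst z)) (snd z)) \<in> borel_measurable ?O"
    using optional_jump[OF Y] by (simp only: case_prod_unfold)
  have [measurable]: "w \<in> borel_measurable ?O"
    using measurable_compose[OF measurable_Pair[OF measurable_ident jump] W] by (simp add: w_def[abs_def])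
  have g: "g k \<in> borel_measurable ?O" for k
    unfolding g_def
    by (intro borel_measurable_times optional_large_jumps_indicator[OF Y]) measurable
  have "(\<lambda>z. \<Sum>s\<in>?J k (fst z) \<inter> {..snd z}. g k (fst z, s)) \<in> borel_measurable ?O" for k
    using optional_sum_large_jumps[OF Y _ g, of "1 / real (Suc k)" k]
    by (simp add: case_prod_unfold g_def)
  then have "(\<lambda>z. SUP k. ennreal (\<Sum>s\<in>?J k (fst z) \<inter> {..snd z}. g k (fst z, s))) \<in> borel_measurable ?O"
    by (intro borel_measurable_SUP measurable_compose[OF _ measurable_ennreal]) auto
  then show "(\<lambda>(\<omega>, t). \<integral>\<^sup>+z\<in>{0..t} \<times> UNIV. W ((\<omega>, fst z), snd z) \<partial>path_measure (jump_measure M Y) \<omega>)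
      \<in> borel_measurable ?O"
  proof (rule measurable_cong[THEN iffD1, rotated])
    fix z assume "z \<in> space ?O"
    then obtain \<omega> t where z: "z = (\<omega>, t)" and \<omega>: "\<omega> \<in> space M" and "0 \<le> t" by auto
    have "(\<lambda>z. W ((\<omega>, fst z), snd z) * indicator ({0..t} \<times> UNIV) z) \<in> borel_measurable mark_space"
      by (intro borel_measurable_times_ennreal borel_measurable_indicator strip_in_mark_space
          measurable_compose[OF measurable_optional_section_mark[OF \<omega>] W])
    from nn_integral_jump_distr[OF this]
    have "(\<integral>\<^sup>+z\<in>{0..t} \<times> UNIV. W ((\<omega>, fst z), snd z) \<partial>path_measure (jump_measure M Y) \<omega>) =
        (\<integral>\<^sup>+s. W ((\<omega>, s), jump (Y \<omega>) s) * indicator ({0..t} \<times> UNIV) (s, jump (Y \<omega>) s)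
          \<partial>count_space (jump_times (Y \<omega>)))"
      by (simp add: path_measure_jump_measure[OF \<omega>])
    also have "\<dots> = (\<integral>\<^sup>+s. w (\<omega>, s) * indicator {..t} s \<partial>count_space (jump_times (Y \<omega>)))"
      by (rule nn_integral_cong) (auto simp: w_def jump_times_def split: split_indicator)
    also have "\<dots> = (SUP k. ennreal (\<Sum>s\<in>?J k \<omega> \<inter> {..t}. g k (\<omega>, s)))"
      unfolding g_def fst_conv snd_conv
      by (rule nn_integral_jump_times_eq_SUP[OF cadlag_imp_regulated[OF Y(2)[OF \<omega>]]])
    finally show "(SUP k. ennreal (\<Sum>s\<in>?J k (fst z) \<inter> {..snd z}. g k (fst z, s))) =
        (case z of (\<omega>, t) \<Rightarrow> \<integral>\<^sup>+z\<in>{0..t} \<times> UNIV. W ((\<omega>, fst z), snd z) \<partial>path_measure (jump_measure M Y) \<omega>)"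
      by (simp add: z)
  qed
qed

lemma measurable_time_optional: "snd \<in> optional_sigma M F \<rightarrow>\<^sub>M restrict_space borel {0..}"
proof (rule measurable_restrict_space2)
  have "(\<lambda>(\<omega>, t). t) \<in> borel_measurable (optional_sigma M F)"
    by (rule cadlag_adapted_optional[of F "\<lambda>_ t. t"])
       (auto simp: adapted_def cadlag_def intro!: continuous_intros tendsto_ident_at)
  then show "snd \<in> borel_measurable (optional_sigma M F)"
    by (simp add: case_prod_unfold)
qed auto

text \<open>
  Up to time \<open>n\<close> the number of points in \<open>G\<close> is the value at \<open>n\<close> of the integral process of the
  indicator of \<open>G\<close>.
\<close>

lemma measurable_jump_measure:
  assumes "optional_random_measure M F (jump_measure M Y)" and G: "G \<in> sets mark_space"
  shows "(\<lambda>\<omega>. jump_measure M Y \<omega> G) \<in> borel_measurable M"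
proof -
  define W :: "('a \<times> real) \<times> real \<Rightarrow> ennreal" where "W z = indicator G (snd (fst z), snd z)" for z
  have "(\<lambda>z. (snd (fst z), snd z)) \<in> optional_sigma M F \<Otimes>\<^sub>M borel \<rightarrow>\<^sub>M mark_space"
    by (intro measurable_Pair measurable_compose[OF measurable_fst measurable_time_optional] measurable_snd)
  from measurable_compose[OF this borel_measurable_indicator[OF G]]
  have W: "W \<in> borel_measurable (optional_sigma M F \<Otimes>\<^sub>M borel)"
    by (simp add: W_def[abs_def])
  let ?strip = "\<lambda>n. {0..real n} \<times> (UNIV :: real set)"
  let ?I = "\<lambda>n \<omega>. \<integral>\<^sup>+z\<in>?strip n. W ((\<omega>, fst z), snd z) \<partial>path_measure (jump_measure M Y) \<omega>"
  have "(\<lambda>(\<omega>, t). \<integral>\<^sup>+z\<in>{0..t} \<times> UNIV. W ((\<omega>, fst z), snd z) \<partial>path_measure (jump_measure M Y) \<omega>)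
      \<in> borel_measurable (optional_sigma M F)"
    using assms(1) W unfolding optional_random_measure_def by blast
  from optional_at_fixed_time[OF this of_nat_0_le_iff]
  have "?I n \<in> borel_measurable (F (real n))" for n
    by simp
  then have "?I n \<in> borel_measurable M" for n
    by (rule measurable_F_imp_M) simp
  then have "(\<lambda>\<omega>. SUP n. ?I n \<omega>) \<in> borel_measurable M"
    by (intro borel_measurable_SUP) auto
  then show ?thesis
  proof (rule measurable_cong[THEN iffD1, rotated])
    fix \<omega> assume \<omega>: "\<omega> \<in> space M"
    let ?N = "jump_distr (Y \<omega>)"
    have I: "?I n \<omega> = emeasure ?N (G \<inter> ?strip n)" for n
    proof -
      have "?I n \<omega> = (\<integral>\<^sup>+z. indicator (G \<inter> ?strip n) z \<partial>?N)"
        unfolding path_measure_jump_measure[OF \<omega>]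
        by (rule nn_integral_cong) (auto simp: W_def split: split_indicator)
      also have "\<dots> = emeasure ?N (G \<inter> ?strip n)"
        by (rule nn_integral_indicator) (simp add: G strip_in_mark_space sets.Int)
      finally show ?thesis .
    qed
    have "(SUP n. emeasure ?N (G \<inter> ?strip n)) = emeasure ?N (\<Union>n. G \<inter> ?strip n)"
      by (rule SUP_emeasure_incseq)
         (auto simp: mono_def G intro!: sets.Int strip_in_mark_space elim: order_trans)
    also have "(\<Union>n. G \<inter> ?strip n) = G"
    proof -
      have "\<exists>n. z \<in> ?strip n" if "z \<in> G" for z
        using that sets.sets_into_space[OF G] real_arch_simple[of "fst z"]
        by (auto simp: space_mark_space mem_Times_iff)
      then show ?thesis by blast
    qed
    finally show "(SUP n. ?I n \<omega>) = jump_measure M Y \<omega> G"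
      by (simp only: I jump_measure_eq_emeasure[OF \<omega> G])
  qed
qed

end

section \<open>Predictable sigma-finiteness\<close>

text \<open>
  A point of \<open>J\<close> is determined by its rank, the number of points before it, so that the weights
  \<open>(1/2) ^ rank\<close> add up to at most the full geometric series.
\<close>

lemma sum_geometric_rank_le:
  fixes J :: "real set"
  assumes fin: "\<And>t. finite (J \<inter> {..t})"
  shows "(\<integral>\<^sup>+s. ennreal ((1/2) ^ card (J \<inter> {..<s})) \<partial>count_space J) \<le> 2"
proof -
  let ?r = "\<lambda>s. card (J \<inter> {..<s})"
  have less: "?r s < ?r t" if "s \<in> J" "s < t" for s t
  proof (rule psubset_card_mono)
    show "finite (J \<inter> {..<t})"
      by (rule finite_subset[OF _ fin[of t]]) auto
    show "J \<inter> {..<s} \<subset> J \<inter> {..<t}"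
      using that by auto
  qed
  have "inj_on ?r J"
    by (rule linorder_inj_onI) (use less in \<open>auto simp: less_le\<close>)
  then have "(\<integral>\<^sup>+s. ennreal ((1/2) ^ ?r s) \<partial>count_space J) =
      (\<integral>\<^sup>+n. ennreal ((1/2) ^ n) \<partial>count_space (?r ` J))"
    by (intro nn_integral_bij_count_space inj_on_imp_bij_betw)
  also have "\<dots> = (\<integral>\<^sup>+n. ennreal ((1/2) ^ n) * indicator (?r ` J) n \<partial>count_space UNIV)"
    by (rule nn_integral_count_space_indicator) simp
  also have "\<dots> \<le> (\<integral>\<^sup>+n. ennreal ((1/2) ^ n) \<partial>count_space UNIV)"
    by (rule nn_integral_mono) (simp split: split_indicator)
  also have "\<dots> = ennreal (\<Sum>n. (1/2) ^ n)"
    unfolding nn_integral_count_space_nat by (rule suminf_ennreal2) (auto intro: summable_geometric)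
  also have "\<dots> = 2"
    by (simp add: suminf_geometric)
  finally show ?thesis .
qed

text \<open>
  The weight of a jump of size \<open>x\<close>, where \<open>r k\<close> is to be \<open>(1/2)\<close> to the power of the number of
  earlier jumps of size greater than \<open>1 / Suc k\<close>. A real \<open>x\<close> different from \<open>0\<close> gets positive
  weight from some \<open>k\<close>; \<open>x = 0\<close> is the size of no jump and may get weight \<open>1\<close>.
\<close>

definition jump_weight :: "(nat \<Rightarrow> real) \<Rightarrow> real \<Rightarrow> real" where
  "jump_weight r x = indicator {0} x + (\<Sum>k. (1/2) ^ k * (r k * indicator {y. 1 / real (Suc k) < \<bar>y\<bar>} x))"

lemma summable_jump_weight:
  assumes "\<And>k. 0 \<le> r k" "\<And>k. r k \<le> 1"
  shows "summable (\<lambda>k. (1/2::real) ^ k * (r k * indicator {y. 1 / real (Suc k) < \<bar>y\<bar>} x))"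
proof (rule summable_comparison_test'[of "\<lambda>k. (1/2) ^ k" 0])
  fix k :: nat
  have "r k * indicator {y. 1 / real (Suc k) < \<bar>y\<bar>} x \<le> 1 * 1"
    using assms by (intro mult_mono) (auto split: split_indicator)
  then have "(1/2::real) ^ k * (r k * indicator {y. 1 / real (Suc k) < \<bar>y\<bar>} x) \<le> (1/2) ^ k * 1"
    by (intro mult_left_mono) auto
  then show "norm ((1/2) ^ k * (r k * indicator {y. 1 / real (Suc k) < \<bar>y\<bar>} x)) \<le> (1/2) ^ k"
    using assms by (simp add: abs_mult)
qed (auto intro: summable_geometric)

lemma jump_weight_pos:
  assumes "\<And>k. 0 < r k" "\<And>k. r k \<le> 1"
  shows "0 < jump_weight r x"
proof -
  let ?f = "\<lambda>k. (1/2::real) ^ k * (r k * indicator {y. 1 / real (Suc k) < \<bar>y\<bar>} x)"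
  have summable: "summable ?f"
    by (rule summable_jump_weight) (use assms in \<open>auto intro: less_imp_le\<close>)
  have nonneg: "0 \<le> ?f k" for k
    using assms(1)[of k] by (simp add: less_imp_le)
  show ?thesis
  proof (cases "x = 0")
    case True
    with suminf_nonneg[OF summable nonneg] show ?thesis
      by (simp add: jump_weight_def)
  next
    case False
    then obtain k where "1 / real (Suc k) < \<bar>x\<bar>"
      using reals_Archimedean[of "\<bar>x\<bar>"] by (auto simp: inverse_eq_divide)
    then have "0 < ?f k"
      using assms(1)[of k] by simp
    from suminf_pos2[OF summable nonneg this] show ?thesis
      using False by (simp add: jump_weight_def)
  qed
qed

lemma measurable_jump_weight:
  assumes "\<And>k. (\<lambda>z. r z k) \<in> borel_measurable A"
  shows "(\<lambda>z. jump_weight (r (fst z)) (snd z)) \<in> borel_measurable (A \<Otimes>\<^sub>M borel)"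
proof -
  have [measurable]: "(\<lambda>z. r (fst z) k) \<in> borel_measurable (A \<Otimes>\<^sub>M borel)" for k
    by (rule measurable_compose[OF measurable_fst assms])
  show ?thesis
    unfolding jump_weight_def by measurable
qed

definition jump_discount :: "(real \<Rightarrow> real) \<Rightarrow> real \<Rightarrow> nat \<Rightarrow> real" where
  "jump_discount f s k = (1/2) ^ card (large_jumps f (1 / real (Suc k)) \<inter> {..<s})"

lemma jump_discount_bounds: "0 < jump_discount f s k" "jump_discount f s k \<le> 1"
  by (simp_all add: jump_discount_def power_le_one)

text \<open>
  The jumps larger than \<open>1 / Suc k\<close> have total discount at most \<open>2\<close>, and these bounds are
  summed against the weights \<open>(1/2) ^ k\<close>.
\<close>

lemma integral_jump_weight_le:
  assumes "regulated f"
  shows "(\<integral>\<^sup>+s. ennreal (jump_weight (jump_discount f s) (jump f s)) \<partial>count_space (jump_times f)) \<le> 4"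
proof -
  let ?J = "\<lambda>k. large_jumps f (1 / real (Suc k))"
  let ?a = "\<lambda>k s. jump_discount f s k * indicator {y. 1 / real (Suc k) < \<bar>y\<bar>} (jump f s)"
  have a_nonneg: "0 \<le> ?a k s" for k s
    using jump_discount_bounds(1)[of f s k] by simp
  have level: "(\<integral>\<^sup>+s. ennreal (?a k s) \<partial>count_space (jump_times f)) \<le> 2" for k
  proof -
    have "(\<integral>\<^sup>+s. ennreal (?a k s) \<partial>count_space (jump_times f)) =
        (\<integral>\<^sup>+s. ennreal (jump_discount f s k) * indicator (?J k) s \<partial>count_space (jump_times f))"
      by (rule nn_integral_cong) (auto simp: jump_times_def large_jumps_def split: split_indicator)
    also have "\<dots> = (\<integral>\<^sup>+s. ennreal (jump_discount f s k) * indicator (?J k) s \<partial>count_space (?J k))"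
      by (rule nn_integral_count_space_eq) (auto simp: jump_times_eq_Union)
    also have "\<dots> = (\<integral>\<^sup>+s. ennreal ((1/2) ^ card (?J k \<inter> {..<s})) \<partial>count_space (?J k))"
      by (rule nn_integral_cong) (simp add: jump_discount_def)
    also have "\<dots> \<le> 2"
      by (rule sum_geometric_rank_le) (use assms in \<open>auto intro: finite_large_jumps\<close>)
    finally show ?thesis .
  qed
  have "(\<integral>\<^sup>+s. ennreal (jump_weight (jump_discount f s) (jump f s)) \<partial>count_space (jump_times f)) =
      (\<integral>\<^sup>+s. (\<Sum>k. ennreal ((1/2) ^ k) * ennreal (?a k s)) \<partial>count_space (jump_times f))"
  proof (rule nn_integral_cong)
    fix s assume "s \<in> space (count_space (jump_times f))"
    then have "jump f s \<noteq> 0"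
      by (simp add: jump_times_def)
    then have "ennreal (jump_weight (jump_discount f s) (jump f s)) = ennreal (\<Sum>k. (1/2) ^ k * ?a k s)"
      by (simp add: jump_weight_def)
    also have "\<dots> = (\<Sum>k. ennreal ((1/2) ^ k * ?a k s))"
    proof (rule suminf_ennreal2[symmetric])
      show "0 \<le> (1/2) ^ k * ?a k s" for k
        by (intro mult_nonneg_nonneg a_nonneg) simp
      show "summable (\<lambda>k. (1/2) ^ k * ?a k s)"
        by (rule summable_jump_weight) (auto intro: jump_discount_bounds less_imp_le)
    qed
    also have "\<dots> = (\<Sum>k. ennreal ((1/2) ^ k) * ennreal (?a k s))"
      by (intro suminf_cong ennreal_mult a_nonneg) simp
    finally show "ennreal (jump_weight (jump_discount f s) (jump f s)) =
        (\<Sum>k. ennreal ((1/2) ^ k) * ennreal (?a k s))" .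
  qed
  also have "\<dots> = (\<Sum>k. \<integral>\<^sup>+s. ennreal ((1/2) ^ k) * ennreal (?a k s) \<partial>count_space (jump_times f))"
    by (rule nn_integral_suminf) simp
  also have "\<dots> = (\<Sum>k. ennreal ((1/2) ^ k) * (\<integral>\<^sup>+s. ennreal (?a k s) \<partial>count_space (jump_times f)))"
    by (intro suminf_cong nn_integral_cmult) simp
  also have "\<dots> \<le> (\<Sum>k. ennreal ((1/2) ^ k) * 2)"
    by (intro suminf_le mult_left_mono level) (auto intro: summableI)
  also have "\<dots> = (\<Sum>k. ennreal ((1/2) ^ k)) * 2"
    by (rule ennreal_suminf_multc)
  also have "(\<Sum>k. ennreal ((1/2) ^ k)) = ennreal (\<Sum>k. (1/2) ^ k)"
    by (rule suminf_ennreal2) (auto intro: summable_geometric)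
  also have "\<dots> * 2 = 4"
    by (simp add: suminf_geometric)
  finally show ?thesis .
qed

context filtered_prob_space
begin

lemma predictably_sigma_finite_jump_measure:
  assumes Y: "adapted F Y" "\<And>\<omega>. \<omega> \<in> space M \<Longrightarrow> cadlag (Y \<omega>)"
  shows "predictably_sigma_finite M F (jump_measure M Y)"
proof -
  define V where "V z = jump_weight (jump_discount (Y (fst (fst z))) (snd (fst z))) (snd z)"
    for z :: "('a \<times> real) \<times> real"
  let ?d = "\<lambda>k \<omega> t. jump_discount (Y \<omega>) t k"
  have discount_powr: "?d k \<omega> t = (1/2) powr real (card (large_jumps (Y \<omega>) (1 / real (Suc k)) \<inter> {..<t}))" for k \<omega> t
    by (simp add: jump_discount_def powr_realpow)
  have "(\<lambda>(\<omega>, t). ?d k \<omega> t) \<in> borel_measurable (predictable_sigma M F)" for k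
  proof (rule left_continuous_adapted_predictable)
    show "adapted F (?d k)"
      using adapted_card_large_jumps_before[OF Y, of "1 / real (Suc k)"]
      unfolding adapted_def discount_powr by (auto intro!: powr_real_measurable)
    show "left_continuous (?d k \<omega>)" if "\<omega> \<in> space M" for \<omega>
      unfolding jump_discount_def
      by (rule left_continuous_large_jumps_before[OF cadlag_imp_regulated[OF Y(2)[OF that]]]) simp
  qed
  then have "V \<in> borel_measurable (predictable_sigma M F \<Otimes>\<^sub>M borel)"
    unfolding V_def by (intro measurable_jump_weight) (simp add: case_prod_unfold)
  \<comment> \<open>Optional processes have Borel paths, so this makes \<open>V\<close> measurable in the marks on each path.\<close>
  moreover have "(\<lambda>z. ?d k (fst z) (snd z)) \<in> borel_measurable (optional_sigma M F)" for k
    using optional_card_large_jumps_before[OF Y, of "1 / real (Suc k)"]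
    unfolding discount_powr by (intro powr_real_measurable) auto
  then have V_optional: "V \<in> borel_measurable (optional_sigma M F \<Otimes>\<^sub>M borel)"
    unfolding V_def by (intro measurable_jump_weight)
  moreover have "0 < V ((\<omega>, s), x)" for \<omega> s x
    unfolding V_def by (intro jump_weight_pos jump_discount_bounds)
  moreover have "(\<integral>\<^sup>+\<omega>. (\<integral>\<^sup>+z. ennreal (V ((\<omega>, fst z), snd z)) \<partial>path_measure (jump_measure M Y) \<omega>) \<partial>M) < \<infinity>"
  proof -
    have "(\<integral>\<^sup>+z. ennreal (V ((\<omega>, fst z), snd z)) \<partial>path_measure (jump_measure M Y) \<omega>) \<le> 4"
      if \<omega>: "\<omega> \<in> space M" for \<omega>
    proof -
      have "(\<lambda>z. ennreal (V ((\<omega>, fst z), snd z))) \<in> borel_measurable mark_space"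
        by (rule measurable_compose[OF measurable_compose[OF measurable_optional_section_mark[OF \<omega>] V_optional]
              measurable_ennreal])
      from nn_integral_jump_distr[OF this, of "Y \<omega>"] integral_jump_weight_le[OF cadlag_imp_regulated[OF Y(2)[OF \<omega>]]]
      show ?thesis
        by (simp add: path_measure_jump_measure[OF \<omega>] V_def)
    qed
    then have "(\<integral>\<^sup>+\<omega>. (\<integral>\<^sup>+z. ennreal (V ((\<omega>, fst z), snd z)) \<partial>path_measure (jump_measure M Y) \<omega>) \<partial>M) \<le> (\<integral>\<^sup>+\<omega>. 4 \<partial>M)"
      by (rule nn_integral_mono)
    also have "\<dots> < \<infinity>"
      by (simp add: emeasure_space_1)
    finally show ?thesis .
  qed
  ultimately show ?thesis
    unfolding predictably_sigma_finite_def by blast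
qed

section \<open>The jump measure is an integer-valued random measure\<close>

lemma integer_valued_random_measure_cadlag:
  assumes Y: "adapted F Y" "\<And>\<omega>. \<omega> \<in> space M \<Longrightarrow> cadlag (Y \<omega>)"
  shows "integer_valued_random_measure M F (jump_measure M Y)"
  unfolding integer_valued_random_measure_def
proof (intro conjI ballI allI impI)
  show optional: "optional_random_measure M F (jump_measure M Y)"
    by (rule optional_random_measure_jump_measure[OF Y])
  show "predictably_sigma_finite M F (jump_measure M Y)"
    by (rule predictably_sigma_finite_jump_measure[OF Y])
  show "(\<lambda>\<omega>. jump_measure M Y \<omega> G) \<in> borel_measurable M" if "G \<in> sets mark_space" for G
    by (rule measurable_jump_measure[OF optional that])
  fix \<omega> assume \<omega>: "\<omega> \<in> space M"
  show "measure_space (space mark_space) (sets mark_space) (jump_measure M Y \<omega>)"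
    by (rule measure_space_jump_measure[OF \<omega>])
  show "jump_measure M Y \<omega> G \<in> range of_nat \<union> {\<infinity>}" if "G \<in> sets mark_space" for G
    using emeasure_jump_distr_in_nat[OF that] by (simp only: jump_measure_eq_emeasure[OF \<omega> that])
  have fibre: "{t} \<times> UNIV \<in> sets mark_space" if "0 \<le> t" for t
    using that by (intro pair_measureI) (auto simp: sets_restrict_space_iff)
  show "jump_measure M Y \<omega> ({0} \<times> UNIV) = 0"
    using emeasure_jump_distr_zero by (simp only: jump_measure_eq_emeasure[OF \<omega> fibre[OF order_refl]])
  show "jump_measure M Y \<omega> ({t} \<times> UNIV) \<le> 1" if "0 \<le> t" for t
    using emeasure_jump_distr_fibre[OF that] by (simp only: jump_measure_eq_emeasure[OF \<omega> fibre[OF that]])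
qed

end

lemma unordered_sum_cong: "(\<And>s. s \<in> L \<Longrightarrow> h s = k s) \<Longrightarrow> unordered_sum h L = unordered_sum k L"
  unfolding unordered_sum_def by (intro SUP_cong refl sum.cong) auto

lemma jump_measure_cong:
  assumes "\<And>\<omega> s. \<omega> \<in> space M \<Longrightarrow> 0 \<le> s \<Longrightarrow> jump (X \<omega>) s = jump (Y \<omega>) s"
  shows "jump_measure M X = jump_measure M Y"
proof (intro ext)
  fix \<omega> G
  show "jump_measure M X \<omega> G = jump_measure M Y \<omega> G"
    unfolding jump_measure_def
    by (rule unordered_sum_cong) (auto simp: jump_set_def assms split: split_indicator)
qed

theorem theorem4p5:
  fixes M :: "'a measure" and F :: "real \<Rightarrow> 'a measure" and X :: "'a \<Rightarrow> real \<Rightarrow> real"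
  assumes "filtered_prob_space M F"
    and "usual_conditions M F"
    and "(\<lambda>(\<omega>, t). X \<omega> t) \<in> borel_measurable (optional_sigma M F)"
    and "\<forall>\<omega>\<in>space M. regulated (X \<omega>)"
  shows "integer_valued_random_measure M F (jump_measure M X)"
proof -
  interpret filtered_prob_space M F by fact
  let ?Y = "\<lambda>\<omega>. right_limit (X \<omega>)"
  have reg: "regulated (X \<omega>)" if "\<omega> \<in> space M" for \<omega>
    using assms(4) that by blast
  have "adapted F X"
    using optional_at_fixed_time[OF assms(3)] by (simp add: adapted_def)
  then have "adapted F ?Y"
    by (rule adapted_right_limit[OF assms(2) _ reg])
  then have "integer_valued_random_measure M F (jump_measure M ?Y)"
    by (rule integer_valued_random_measure_cadlag) (rule cadlag_right_limit_function[OF reg])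
  also have "jump_measure M ?Y = jump_measure M X"
    by (rule jump_measure_cong) (rule jump_right_limit_function[OF reg])
  finally show ?thesis .
qed

end
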